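(* Let $K$ be a field, $S=K[x_1,\dots,x_n]$ with $\mathfrak{m}=(x_1,\dots,x_n)$, and let $I\subset S$ be a graded ideal with linear resolution. Suppose that $\mathfrak{m}I$ is polymatroidal. Then $\mathrm{soc}(\mathfrak{m}I)=I$, and so $I$ is polymatroidal.
   Context: $S$ is standard graded. A graded ideal $L\subset S$ has a linear resolution if for some $d$ one has $\mathrm{Tor}_i^S(K,L)_{i+j}=0$ for all $i$ and all $j\neq d$. For a monomial ideal $J$, $\mathcal{G}(J)$ denotes its minimal set of monomial generators, and $\deg_{x_i}(u)$ is the exponent of $x_i$ in the monomial $u$. The socle of a monomial ideal $J\subset S$ is the ideal $\mathrm{soc}(J)=(\mathbf{x}^{\mathbf a}:\ \mathbf{x}^{\mathbf a}\in(J:\mathfrak{m})\setminus J)$. A nonzero monomial ideal $J$ is polymatroidal if all elements of $\mathcal{G}(J)$ have the same degree and: for all $u,v\in\mathcal{G}(J)$ and all $i$ with $\deg_{x_i}(u)>\deg_{x_i}(v)$, there is $j$ with $\deg_{x_j}(u)<\deg_{x_j}(v)$ such that $x_j(u/x_i)\in\mathcal{G}(J)$. *)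

theory Defs
  imports "HOL-Library.Poly_Mapping" "Jordan_Normal_Form.Matrix"
begin

text \<open>
  The polynomial ring over \<open>'k\<close> in the variables indexed by the finite type \<open>'x\<close>. The exponent
  vector \<open>a :: 'x \<Rightarrow>\<^sub>0 nat\<close> encodes the monomial \<open>x\<^sup>a\<close>.
\<close>

type_synonym 'x expo = "'x \<Rightarrow>\<^sub>0 nat"
type_synonym ('x, 'k) mpol = "'x expo \<Rightarrow>\<^sub>0 'k"

text \<open>
  Ideals of a commutative ring are its submodules: \<open>ideal.subspace I\<close> says that \<open>I\<close> is an ideal and
  \<open>ideal.span A\<close> is the ideal generated by \<open>A\<close>.
\<close>

global_interpretation ideal: Modules.module "(*) :: 'a::comm_ring_1 \<Rightarrow> 'a \<Rightarrow> 'a"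
  by unfold_locales (simp_all add: algebra_simps)

definition ideal_mult :: "'a::comm_ring_1 set \<Rightarrow> 'a set \<Rightarrow> 'a set" where
  "ideal_mult I J = ideal.span {f * g | f g. f \<in> I \<and> g \<in> J}"

definition ideal_colon :: "'a::comm_ring_1 set \<Rightarrow> 'a set \<Rightarrow> 'a set" where
  "ideal_colon I J = {f. \<forall>g\<in>J. f * g \<in> I}"

definition xmon :: "'x expo \<Rightarrow> ('x, 'k::comm_ring_1) mpol" where
  "xmon a = Poly_Mapping.single a 1"

abbreviation var_expo :: "'x \<Rightarrow> 'x expo" where
  "var_expo i \<equiv> Poly_Mapping.single i 1"

definition max_ideal :: "('x, 'k::comm_ring_1) mpol set" where
  "max_ideal = ideal.span (range (\<lambda>i. xmon (var_expo i)))"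

definition mdeg :: "'x::finite expo \<Rightarrow> nat" where
  "mdeg a = (\<Sum>i\<in>UNIV. Poly_Mapping.lookup a i)"

text \<open>Degrees are integers, as for graded modules; \<open>0\<close> is homogeneous of every degree.\<close>

definition homogeneous :: "int \<Rightarrow> ('x::finite, 'k::zero) mpol \<Rightarrow> bool" where
  "homogeneous d f \<longleftrightarrow> (\<forall>a\<in>Poly_Mapping.keys f. int (mdeg a) = d)"

definition hom_component :: "nat \<Rightarrow> ('x::finite, 'k::comm_monoid_add) mpol \<Rightarrow> ('x, 'k) mpol" where
  "hom_component d f =
     (\<Sum>a\<in>{a \<in> Poly_Mapping.keys f. mdeg a = d}. Poly_Mapping.single a (Poly_Mapping.lookup f a))"

definition graded_ideal :: "('x::finite, 'k::comm_ring_1) mpol set \<Rightarrow> bool" where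
  "graded_ideal I \<longleftrightarrow> ideal.subspace I \<and> (\<forall>f\<in>I. \<forall>d. hom_component d f \<in> I)"


section \<open>Tor and linear resolutions\<close>

text \<open>
  Data of a complex of finitely generated graded free modules augmented to \<open>K\<close>,
  \<open>\<dots> \<rightarrow> F\<^sub>2 \<rightarrow> F\<^sub>1 \<rightarrow> F\<^sub>0 \<rightarrow> K \<rightarrow> 0\<close>. Here \<open>F\<^sub>i\<close> is free of rank \<open>rnk F i\<close>, its \<open>b\<close>-th basis element has degree
  \<open>shift F i b\<close>, and \<open>bd F i\<close> is the matrix of \<open>F\<^sub>i\<^sub>+\<^sub>1 \<rightarrow> F\<^sub>i\<close>. As \<open>x\<^sub>1, \<dots>, x\<^sub>n\<close> act as zero on \<open>K\<close>, the linear
  map \<open>F\<^sub>0 \<rightarrow> K\<close> is determined by the images \<open>aug F $ b\<close> of the basis elements.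
\<close>

record (overloaded) ('x, 'k) free_complex =
  rnk :: "nat \<Rightarrow> nat"
  shift :: "nat \<Rightarrow> nat \<Rightarrow> int"
  bd :: "nat \<Rightarrow> ('x, 'k) mpol mat"
  aug :: "'k vec"

definition aug_map :: "('x, 'k::comm_ring_1) free_complex \<Rightarrow> ('x, 'k) mpol vec \<Rightarrow> 'k" where
  "aug_map F v = aug F \<bullet> map_vec (\<lambda>f. Poly_Mapping.lookup f 0) v"

definition free_resolution_of_K :: "('x::finite, 'k::comm_ring_1) free_complex \<Rightarrow> bool" where
  "free_resolution_of_K F \<longleftrightarrow>
     (\<forall>i. bd F i \<in> carrier_mat (rnk F i) (rnk F (Suc i))) \<and>
     (\<forall>i. \<forall>p<rnk F i. \<forall>q<rnk F (Suc i).
        homogeneous (shift F (Suc i) q - shift F i p) (bd F i $$ (p, q))) \<and>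
     aug F \<in> carrier_vec (rnk F 0) \<and>
     (\<forall>b<rnk F 0. aug F $ b \<noteq> 0 \<longrightarrow> shift F 0 b = 0) \<and>
     aug_map F ` carrier_vec (rnk F 0) = UNIV \<and>
     {v \<in> carrier_vec (rnk F 0). aug_map F v = 0} =
       (\<lambda>w. bd F 0 *\<^sub>v w) ` carrier_vec (rnk F 1) \<and>
     (\<forall>i. {v \<in> carrier_vec (rnk F (Suc i)). bd F i *\<^sub>v v = 0\<^sub>v (rnk F i)} =
       (\<lambda>w. bd F (Suc i) *\<^sub>v w) ` carrier_vec (rnk F (Suc (Suc i))))"

text \<open>
  \<open>tensor_part F L i k\<close> is the degree \<open>k\<close> component of \<open>F\<^sub>i \<otimes> L\<close>, which is the direct sum of the
  \<open>L(-shift F i b)\<close> over \<open>b < rnk F i\<close>. The differential of \<open>F \<otimes> L\<close> is given by the matrices \<open>bd F i\<close>.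
\<close>

definition tensor_part ::
  "('x::finite, 'k::comm_ring_1) free_complex \<Rightarrow> ('x, 'k) mpol set \<Rightarrow> nat \<Rightarrow> int \<Rightarrow> ('x, 'k) mpol vec set" where
  "tensor_part F L i k =
     {v \<in> carrier_vec (rnk F i). \<forall>b<rnk F i. v $ b \<in> L \<and> homogeneous (k - shift F i b) (v $ b)}"

definition tor_cycles ::
  "('x::finite, 'k::comm_ring_1) free_complex \<Rightarrow> ('x, 'k) mpol set \<Rightarrow> nat \<Rightarrow> int \<Rightarrow> ('x, 'k) mpol vec set" where
  "tor_cycles F L i k =
     {v \<in> tensor_part F L i k. \<forall>i'. i = Suc i' \<longrightarrow> bd F i' *\<^sub>v v = 0\<^sub>v (rnk F i')}"

definition tor_boundaries ::
  "('x::finite, 'k::comm_ring_1) free_complex \<Rightarrow> ('x, 'k) mpol set \<Rightarrow> nat \<Rightarrow> int \<Rightarrow> ('x, 'k) mpol vec set" where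
  "tor_boundaries F L i k = (\<lambda>w. bd F i *\<^sub>v w) ` tensor_part F L (Suc i) k"

text \<open>
  The vanishing of the degree \<open>k\<close> component of \<open>Tor\<^sub>i(K, L)\<close>, i.e. of the degree \<open>k\<close> component of
  \<open>H\<^sub>i(F \<otimes> L)\<close>. Up to isomorphism this does not depend on the resolution \<open>F\<close> of \<open>K\<close>.
\<close>

definition tor_vanishes :: "nat \<Rightarrow> int \<Rightarrow> ('x::finite, 'k::comm_ring_1) mpol set \<Rightarrow> bool" where
  "tor_vanishes i k L \<longleftrightarrow>
     (\<forall>F. free_resolution_of_K F \<longrightarrow> tor_cycles F L i k = tor_boundaries F L i k)"

definition has_linear_resolution :: "('x::finite, 'k::comm_ring_1) mpol set \<Rightarrow> bool" where
  "has_linear_resolution L \<longleftrightarrow> (\<exists>d. \<forall>i j. j \<noteq> d \<longrightarrow> tor_vanishes i (int i + j) L)"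


section \<open>Monomial ideals\<close>

definition monomial_ideal :: "('x, 'k::comm_ring_1) mpol set \<Rightarrow> bool" where
  "monomial_ideal J \<longleftrightarrow> (\<exists>A. J = ideal.span (xmon ` A))"

text \<open>
  The (exponent vectors of the) minimal set of monomial generators of a monomial ideal. By
  \<open>min_gens_eq\<close> below it is well defined.
\<close>

definition is_min_gens :: "('x, 'k::comm_ring_1) mpol set \<Rightarrow> 'x expo set \<Rightarrow> bool" where
  "is_min_gens J A \<longleftrightarrow> ideal.span (xmon ` A) = J \<and> (\<forall>B. B \<subset> A \<longrightarrow> ideal.span (xmon ` B) \<noteq> J)"

definition min_gens :: "('x, 'k::comm_ring_1) mpol set \<Rightarrow> 'x expo set" where
  "min_gens J = (THE A. is_min_gens J A)"

definition polymatroidal :: "('x::finite, 'k::comm_ring_1) mpol set \<Rightarrow> bool" where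
  "polymatroidal J \<longleftrightarrow> monomial_ideal J \<and> J \<noteq> {0} \<and>
     (\<forall>u\<in>min_gens J. \<forall>v\<in>min_gens J. mdeg u = mdeg v) \<and>
     (\<forall>u\<in>min_gens J. \<forall>v\<in>min_gens J. \<forall>i. Poly_Mapping.lookup u i > Poly_Mapping.lookup v i \<longrightarrow>
        (\<exists>j. Poly_Mapping.lookup u j < Poly_Mapping.lookup v j \<and>
             var_expo j + (u - var_expo i) \<in> min_gens J))"

definition soc :: "('x, 'k::comm_ring_1) mpol set \<Rightarrow> ('x, 'k) mpol set" where
  "soc J = ideal.span (xmon ` {a. xmon a \<in> ideal_colon J max_ideal - J})"

lemma xmon_in_span_iff:
  "(xmon a :: ('x, 'k::comm_ring_1) mpol) \<in> ideal.span (xmon ` A) \<longleftrightarrow> (\<exists>b\<in>A. \<exists>c. a = b + c)"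
proof
  let ?T = "{f :: ('x, 'k) mpol. \<forall>a\<in>Poly_Mapping.keys f. \<exists>b\<in>A. \<exists>c. a = b + c}"
  have "ideal.subspace ?T"
  proof (rule ideal.subspaceI)
    fix x y :: "('x, 'k) mpol"
    assume "x \<in> ?T" "y \<in> ?T"
    then show "x + y \<in> ?T"
      using Poly_Mapping.keys_add[of x y] by blast
  next
    fix c x :: "('x, 'k) mpol"
    assume x: "x \<in> ?T"
    show "c * x \<in> ?T"
    proof (clarify)
      fix a assume "a \<in> Poly_Mapping.keys (c * x)"
      then obtain p q where pq: "a = p + q" "q \<in> Poly_Mapping.keys x"
        using keys_mult[of c x] by blast
      then obtain b d where "b \<in> A" "q = b + d" using x by blast
      then have "a = b + (p + d)" using pq by (simp add: ac_simps)
      then show "\<exists>b\<in>A. \<exists>c. a = b + c" using \<open>b \<in> A\<close> by blast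
    qed
  qed simp
  moreover have "xmon ` A \<subseteq> ?T"
    by (auto simp: xmon_def split: if_splits) (metis add.right_neutral)
  ultimately have "ideal.span (xmon ` A) \<subseteq> ?T"
    by (rule ideal.span_minimal[rotated])
  moreover assume "(xmon a :: ('x, 'k) mpol) \<in> ideal.span (xmon ` A)"
  ultimately show "\<exists>b\<in>A. \<exists>c. a = b + c"
    by (auto simp: xmon_def)
next
  assume "\<exists>b\<in>A. \<exists>c. a = b + c"
  then obtain b c where "b \<in> A" "a = b + c" by blast
  then have "(xmon a :: ('x, 'k) mpol) = xmon c * xmon b"
    by (simp add: xmon_def mult_single add.commute)
  then show "(xmon a :: ('x, 'k) mpol) \<in> ideal.span (xmon ` A)"
    using \<open>b \<in> A\<close> by (simp add: ideal.span_base ideal.span_scale)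
qed

lemma min_gens_eq:
  fixes J :: "('x::finite, 'k::comm_ring_1) mpol set"
  assumes "monomial_ideal J"
  shows "is_min_gens J (min_gens J)"
    and "is_min_gens J A \<longleftrightarrow> A = min_gens J"
    and "min_gens J = {a. xmon a \<in> J \<and> (\<forall>b c. xmon b \<in> J \<and> a = b + c \<longrightarrow> b = a)}"
proof -
  define M where "M = {a. (xmon a :: ('x, 'k) mpol) \<in> J \<and> (\<forall>b c. (xmon b :: ('x, 'k) mpol) \<in> J \<and> a = b + c \<longrightarrow> b = a)}"
  obtain A0 where A0: "J = ideal.span (xmon ` A0)"
    using assms unfolding monomial_ideal_def by blast
  have mdeg_add: "mdeg (a + b) = mdeg a + mdeg b" for a b :: "'x expo"
    by (simp add: mdeg_def lookup_add sum.distrib)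
  have mdeg_0: "a = 0" if "mdeg a = 0" for a :: "'x expo"
    using that by (intro poly_mapping_eqI) (simp add: mdeg_def)
  have M_below: "\<exists>b\<in>M. \<exists>c. a = b + c" if "(xmon a :: ('x, 'k) mpol) \<in> J" for a
    using that
  proof (induction "mdeg a" arbitrary: a rule: less_induct)
    case less
    show ?case
    proof (cases "a \<in> M")
      case True
      then show ?thesis by (metis add.right_neutral)
    next
      case False
      then obtain b c where bc: "(xmon b :: ('x, 'k) mpol) \<in> J" "a = b + c" "b \<noteq> a"
        using less.prems by (auto simp: M_def)
      then have "mdeg c \<noteq> 0" using mdeg_0 by fastforce
      then have "mdeg b < mdeg a" using bc by (simp add: mdeg_add)
      then obtain d e where "d \<in> M" "b = d + e" using less.hyps bc(1) by blast
      then show ?thesis using bc(2) by (metis add.assoc)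
    qed
  qed
  have span_sub: "J \<subseteq> ideal.span (xmon ` M)"
    unfolding A0
  proof (rule ideal.span_minimal)
    show "xmon ` A0 \<subseteq> (ideal.span (xmon ` M) :: ('x, 'k) mpol set)"
    proof (rule image_subsetI)
      fix a assume "a \<in> A0"
      then have "(xmon a :: ('x, 'k) mpol) \<in> J"
        unfolding A0 by (auto intro: ideal.span_base)
      from M_below[OF this] show "(xmon a :: ('x, 'k) mpol) \<in> ideal.span (xmon ` M)"
        by (simp add: xmon_in_span_iff)
    qed
  qed simp
  have M_J: "xmon ` M \<subseteq> J" by (auto simp: M_def)
  have gen_M: "M \<subseteq> A" if "ideal.span (xmon ` A) = J" for A
  proof
    fix a assume a: "a \<in> M"
    then have "(xmon a :: ('x, 'k) mpol) \<in> ideal.span (xmon ` A)" using that by (simp add: M_def)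
    then obtain b c where b: "b \<in> A" "a = b + c" by (auto simp: xmon_in_span_iff)
    then have "(xmon b :: ('x, 'k) mpol) \<in> J" using that by (auto intro: ideal.span_base)
    then have "b = a" using a b(2) unfolding M_def by blast
    then show "a \<in> A" using b(1) by simp
  qed
  have "ideal.subspace J" unfolding A0 by simp
  then have span_M: "ideal.span (xmon ` M) = J"
    using span_sub ideal.span_minimal[OF M_J] by blast
  have iff: "is_min_gens J A \<longleftrightarrow> A = M" for A
    using gen_M span_M unfolding is_min_gens_def by (metis psubsetI subset_antisym less_le_not_le)
  have "min_gens J = M" unfolding min_gens_def by (rule the_equality) (simp_all add: iff)
  with iff show "is_min_gens J (min_gens J)" "is_min_gens J A \<longleftrightarrow> A = min_gens J"
    and "min_gens J = {a. xmon a \<in> J \<and> (\<forall>b c. xmon b \<in> J \<and> a = b + c \<longrightarrow> b = a)}"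
    by (auto simp: M_def)
qed

end

theory Submission
  imports Defs "HOL-Library.Countable"
begin

text \<open>
  Put \<open>J = \<mm>I\<close>, with generators \<open>B\<close>. The Koszul complex resolves \<open>K\<close>. Vanishing of \<open>Tor\<^sub>0\<close> off the
  line shows that \<open>I\<close> is generated in a single degree \<open>d\<close>, hence \<open>J\<close> in degree \<open>d + 1\<close>. Vanishing of
  \<open>Tor\<^sub>n\<^sub>-\<^sub>1\<close> off the line says that \<open>S / I\<close> has no socle in degree \<open>d\<close>: a form \<open>f\<close> of degree \<open>d\<close> with
  \<open>\<mm>f \<subseteq> I\<close> lies in \<open>I\<close>. By the exchange property, every monomial of \<open>(J : \<mm>) - J\<close> has degree \<open>d\<close>, so
  \<open>soc J \<subseteq> I\<close>, and the converse follows from \<open>\<mm>I = J\<close> and degrees. Thus \<open>I\<close> is generated by the \<open>x\<^sup>u\<close>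
  with \<open>u + e\<^sub>k \<in> B\<close> for all \<open>k\<close>, and these \<open>u\<close> inherit the exchange property by uncrossing tight sets.
\<close>

declare One_nat_def [simp del] \<comment> \<open>it would unfold \<open>var_expo i\<close> to \<open>single i (Suc 0)\<close>\<close>

section \<open>Degrees and unit moves of exponent vectors\<close>

lemma mdeg_add: "mdeg (a + b) = mdeg a + mdeg b"
  by (simp add: mdeg_def lookup_add sum.distrib)

lemma mdeg_var_expo [simp]: "mdeg (var_expo i) = 1"
  by (simp add: mdeg_def lookup_single when_def)

lemma mdeg_eq_0_iff [simp]: "mdeg a = 0 \<longleftrightarrow> a = 0"
  by (auto simp: mdeg_def intro: poly_mapping_eqI)

lemma minus_var_expo_add:
  "Poly_Mapping.lookup a i > 0 \<Longrightarrow> (a - var_expo i) + var_expo i = a"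
  by (rule poly_mapping_eqI) (auto simp: lookup_add lookup_minus lookup_single when_def)

lemma lookup_move:
  assumes "Poly_Mapping.lookup b p > 0" "p \<noteq> q"
  shows "Poly_Mapping.lookup (var_expo q + (b - var_expo p)) l =
    (if l = q then Suc (Poly_Mapping.lookup b l)
     else if l = p then Poly_Mapping.lookup b l - 1 else Poly_Mapping.lookup b l)"
  using assms by (auto simp: lookup_add lookup_minus lookup_single when_def)

section \<open>Exchange families\<close>

definition weight :: "'x expo \<Rightarrow> 'x set \<Rightarrow> nat" where
  "weight u A = (\<Sum>l\<in>A. Poly_Mapping.lookup u l)"

text \<open>These are the bases of a discrete polymatroid, possibly empty; separated from the ideal
  so that the combinatorics involves no coefficients.\<close>

definition exchange_family :: "'x::finite expo set \<Rightarrow> bool" where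
  "exchange_family B \<longleftrightarrow> (\<forall>u\<in>B. \<forall>v\<in>B. mdeg u = mdeg v) \<and>
     (\<forall>u\<in>B. \<forall>v\<in>B. \<forall>i. Poly_Mapping.lookup u i > Poly_Mapping.lookup v i \<longrightarrow>
        (\<exists>j. Poly_Mapping.lookup u j < Poly_Mapping.lookup v j \<and> var_expo j + (u - var_expo i) \<in> B))"

lemma polymatroidal_iff:
  "polymatroidal J \<longleftrightarrow> monomial_ideal J \<and> J \<noteq> {0} \<and> exchange_family (min_gens J)"
  unfolding polymatroidal_def exchange_family_def by blast

lemma weight_add: "weight (a + b) A = weight a A + weight b A"
  by (simp add: weight_def lookup_add sum.distrib)

lemma weight_var_expo: "weight (var_expo i) (A :: 'x::finite set) = (if i \<in> A then 1 else 0)"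
  by (simp add: weight_def lookup_single when_def)

lemma mdeg_eq_weight: "mdeg u = weight u A + weight u (- A)"
  unfolding mdeg_def weight_def by (metis finite Compl_partition Diff_cancel Diff_eq Diff_triv Int_commute Compl_disjoint sum.union_disjoint)

lemma weight_mono:
  "(\<And>l. l \<in> A \<Longrightarrow> Poly_Mapping.lookup u l \<le> Poly_Mapping.lookup v l) \<Longrightarrow> weight u A \<le> weight v A"
  unfolding weight_def by (rule sum_mono)

text \<open>Subtraction of exponents truncates at 0, so a move taken from a variable absent from
  \<open>b\<close> would raise the degree by one. Constancy of the degree on an exchange family thus
  shows that every move staying in the family is a genuine exchange.\<close>

lemma mdeg_move:
  assumes "mdeg (var_expo j + (b - var_expo p)) = mdeg b"
  shows "Poly_Mapping.lookup b p > 0"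
proof (rule ccontr)
  assume "\<not> ?thesis"
  then have "b - var_expo p = b"
    by (intro poly_mapping_eqI) (auto simp: lookup_minus lookup_single when_def)
  then show False using assms by (simp add: mdeg_add)
qed

section \<open>Tight sets and uncrossing\<close>

definition exchange_closed :: "'x::finite expo set \<Rightarrow> 'x expo \<Rightarrow> 'x set \<Rightarrow> bool" where
  "exchange_closed B b A \<longleftrightarrow> (\<forall>q\<in>A. \<forall>p. p \<notin> A \<longrightarrow> var_expo q + (b - var_expo p) \<notin> B)"

lemma exchange_closed_Un:
  "exchange_closed B b A \<Longrightarrow> exchange_closed B b A' \<Longrightarrow> exchange_closed B b (A \<union> A')"
  unfolding exchange_closed_def by blast

text \<open>
  A set closed under the exchanges available at \<open>b\<close> is tight for \<open>b\<close>. The induction moves a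
  competitor \<open>b'\<close> towards \<open>b\<close> by removing its excess outside \<open>A\<close>, which does not decrease its
  weight on \<open>A\<close>.
\<close>

lemma weight_le_if_exchange_closed:
  assumes B: "exchange_family B" and b: "b \<in> B" and A: "exchange_closed B b A" and b': "b' \<in> B"
  shows "weight b' A \<le> weight b A"
  using b'
proof (induction "mdeg (b' - b)" arbitrary: b' rule: less_induct)
  case less
  have deg: "mdeg b' = mdeg b" using B b less.prems unfolding exchange_family_def by blast
  show ?case
  proof (cases "\<exists>q. q \<notin> A \<and> Poly_Mapping.lookup b' q > Poly_Mapping.lookup b q")
    case True
    then obtain q where q: "q \<notin> A" "Poly_Mapping.lookup b' q > Poly_Mapping.lookup b q" by blast
    then obtain j where j: "Poly_Mapping.lookup b' j < Poly_Mapping.lookup b j"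
      and mem: "var_expo j + (b' - var_expo q) \<in> B" (is "?b'' \<in> B")
      using B b less.prems unfolding exchange_family_def by blast
    have lk: "Poly_Mapping.lookup ?b'' l =
      (if l = j then Suc (Poly_Mapping.lookup b' l)
       else if l = q then Poly_Mapping.lookup b' l - 1 else Poly_Mapping.lookup b' l)" for l
      using q j by (intro lookup_move) auto
    \<comment> \<open>By truncation the measure is the total excess of \<open>b'\<close> over
      \<open>b\<close>. It drops at \<open>q\<close>, and no excess arises at \<open>j\<close>,
      where \<open>b'\<close> was strictly below \<open>b\<close>.\<close>
    have "mdeg (?b'' - b) < mdeg (b' - b)"
      unfolding mdeg_def
    proof (rule sum_strict_mono_ex1)
      show "\<forall>x\<in>UNIV. Poly_Mapping.lookup (?b'' - b) x \<le> Poly_Mapping.lookup (b' - b) x"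
        using q j by (auto simp: lookup_minus[of _ b] lk)
      show "\<exists>x\<in>UNIV. Poly_Mapping.lookup (?b'' - b) x < Poly_Mapping.lookup (b' - b) x"
        using q j by (intro bexI[of _ q]) (auto simp: lookup_minus[of _ b] lk)
    qed simp
    then have "weight ?b'' A \<le> weight b A" using mem by (rule less.hyps)
    moreover have "weight b' A \<le> weight ?b'' A"
      using q by (intro weight_mono) (auto simp: lk)
    ultimately show ?thesis by simp
  next
    case False
    \<comment> \<open>Now all excess of \<open>b'\<close> lies in \<open>A\<close>. If
      \<open>b'\<close> were heavier on \<open>A\<close>, then \<open>b\<close> would be larger
      somewhere outside \<open>A\<close>, and the exchange of \<open>b\<close> against
      \<open>b'\<close> there would bring a unit into \<open>A\<close>.\<close>
    show ?thesis
    proof (rule ccontr)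
      assume gt: "\<not> ?thesis"
      have "\<exists>p. p \<notin> A \<and> Poly_Mapping.lookup b' p < Poly_Mapping.lookup b p"
      proof (rule ccontr)
        assume "\<not> ?thesis"
        then have "weight b (- A) \<le> weight b' (- A)" by (intro weight_mono) force
        then show False using gt deg by (simp add: mdeg_eq_weight[of _ A])
      qed
      then obtain p where p: "p \<notin> A" "Poly_Mapping.lookup b' p < Poly_Mapping.lookup b p" by blast
      then obtain q where q: "Poly_Mapping.lookup b q < Poly_Mapping.lookup b' q"
        and mem: "var_expo q + (b - var_expo p) \<in> B"
        using B b less.prems unfolding exchange_family_def by blast
      have "q \<in> A" using False q by blast
      then show False using A p mem unfolding exchange_closed_def by blast
    qed
  qed
qed

text \<open>Exchanges at a fixed \<open>b\<close> are transitive: if a unit can move from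
  \<open>p\<close> to \<open>q\<close> and from \<open>q\<close> to \<open>j\<close>, it can move
  from \<open>p\<close> to \<open>j\<close> directly. So the sources of one-step moves to
  \<open>j\<close>, together with \<open>j\<close>, admit no move from outside.\<close>

lemma exchange_closed_reachable:
  assumes B: "exchange_family B" and b: "b \<in> B"
  shows "exchange_closed B b (insert j {l. var_expo j + (b - var_expo l) \<in> B})" (is "exchange_closed B b ?D")
  unfolding exchange_closed_def
proof (intro ballI allI impI notI)
  fix q p
  assume q: "q \<in> ?D" and p: "p \<notin> ?D" and y: "var_expo q + (b - var_expo p) \<in> B" (is "?y \<in> B")
  have x: "var_expo j + (b - var_expo q) \<in> B" (is "?x \<in> B")
    using p q y by (cases "q = j") auto
  have "q \<noteq> j" "p \<noteq> j" "p \<noteq> q" using p q y by auto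
  have pos: "Poly_Mapping.lookup b p > 0" "Poly_Mapping.lookup b q > 0"
    using B b x y unfolding exchange_family_def by (blast intro: mdeg_move)+
  have lx: "Poly_Mapping.lookup ?x l = (if l = j then Suc (Poly_Mapping.lookup b l)
       else if l = q then Poly_Mapping.lookup b l - 1 else Poly_Mapping.lookup b l)" for l
    using pos \<open>q \<noteq> j\<close> by (intro lookup_move) auto
  have ly: "Poly_Mapping.lookup ?y l = (if l = q then Suc (Poly_Mapping.lookup b l)
       else if l = p then Poly_Mapping.lookup b l - 1 else Poly_Mapping.lookup b l)" for l
    using pos \<open>p \<noteq> q\<close> by (intro lookup_move) auto
  have "Poly_Mapping.lookup ?x p > Poly_Mapping.lookup ?y p"
    using pos \<open>p \<noteq> j\<close> \<open>p \<noteq> q\<close> by (simp add: lx ly)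
  then obtain r where r: "Poly_Mapping.lookup ?x r < Poly_Mapping.lookup ?y r"
    and mem: "var_expo r + (?x - var_expo p) \<in> B"
    using B x y unfolding exchange_family_def by blast
  \<comment> \<open>The only coordinate where \<open>?x\<close> is below \<open>?y\<close> is
    \<open>q\<close>, so the exchange property composes the two moves.\<close>
  have "r = q" using r by (auto simp: lx ly split: if_splits)
  moreover have "var_expo q + (?x - var_expo p) = var_expo j + (b - var_expo p)"
    using pos \<open>p \<noteq> j\<close> \<open>p \<noteq> q\<close> \<open>q \<noteq> j\<close>
    by (intro poly_mapping_eqI) (auto simp: lookup_add lookup_minus lookup_single when_def)
  ultimately show False using mem p by simp
qed

text \<open>When \<open>B\<close> generates \<mm>I, this set will turn out to be the generators of
  \<open>I\<close>. The difficulty is that each \<open>k\<close> may offer its own exchange partners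
  for \<open>i\<close>, whereas a single \<open>j\<close> has to serve all \<open>k\<close> at
  once.\<close>

lemma exchange_family_residual:
  assumes B: "exchange_family B"
  shows "exchange_family {u. \<forall>k. u + var_expo k \<in> B}" (is "exchange_family ?C")
proof -
  have deg: "mdeg u = mdeg v" if "u \<in> ?C" "v \<in> ?C" for u v
  proof -
    have "mdeg (u + var_expo undefined) = mdeg (v + var_expo undefined)"
      using that B unfolding exchange_family_def by blast
    then show ?thesis by (simp add: mdeg_add)
  qed
  have "\<exists>j. Poly_Mapping.lookup u j < Poly_Mapping.lookup v j \<and> var_expo j + (u - var_expo i) \<in> ?C"
    if u: "u \<in> ?C" and v: "v \<in> ?C" and i: "Poly_Mapping.lookup u i > Poly_Mapping.lookup v i" for u v i
  proof (rule ccontr)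
    assume no: "\<not> ?thesis"
    \<comment> \<open>For \<open>k \<in> A\<close>, the set \<open>A\<close> is tight for \<open>u + var_expo k \<in> B\<close>. Maximal members of \<open>T\<close> are
      disjoint and cover all coordinates with \<open>u < v\<close>, which forces \<open>mdeg v < mdeg u\<close>.\<close>
    define T where "T = {A. i \<notin> A \<and> A \<noteq> {} \<and> (\<forall>b\<in>B. weight b A \<le> weight u A + 1)}"
    have "finite T" by simp
    \<comment> \<open>Uncrossing: a common element \<open>k\<close> makes both sets closed under the
      exchanges at the same vector \<open>u + var_expo k\<close>. A move into either set would raise
      its weight to that of \<open>u\<close> plus 2, against the bound in \<open>T\<close>.\<close>
    have T_Un: "A \<union> A' \<in> T" if A: "A \<in> T" and A': "A' \<in> T" and "A \<inter> A' \<noteq> {}" for A A'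
    proof -
      obtain k where k: "k \<in> A" "k \<in> A'" using \<open>A \<inter> A' \<noteq> {}\<close> by blast
      let ?b = "u + var_expo k"
      have b: "?b \<in> B" using u by blast
      have closed: "exchange_closed B ?b A" if A: "A \<in> T" and k: "k \<in> A" for A
        unfolding exchange_closed_def
      proof (intro ballI allI impI notI)
        fix q p assume q: "q \<in> A" and p: "p \<notin> A" and mem: "var_expo q + (?b - var_expo p) \<in> B"
        have "weight (?b - var_expo p) A = weight ?b A"
          unfolding weight_def using p by (intro sum.cong) (auto simp: lookup_minus lookup_single when_def)
        then have "weight (var_expo q + (?b - var_expo p)) A = weight u A + 2"
          using q k by (simp add: weight_add weight_var_expo)
        then show False using A mem unfolding T_def by force
      qed
      have "exchange_closed B ?b (A \<union> A')"
        using closed A A' k by (intro exchange_closed_Un) blast+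
      then have "\<forall>b'\<in>B. weight b' (A \<union> A') \<le> weight ?b (A \<union> A')"
        using weight_le_if_exchange_closed B b by blast
      then show ?thesis using A A' k by (simp add: T_def weight_add weight_var_expo)
    qed
    have T_le: "weight v A \<le> weight u A" if A: "A \<in> T" for A
    proof -
      obtain k where "k \<in> A" using A unfolding T_def by auto
      have "v + var_expo k \<in> B" using v by blast
      then have "weight (v + var_expo k) A \<le> weight u A + 1" using A unfolding T_def by blast
      then show ?thesis using \<open>k \<in> A\<close> by (simp add: weight_add weight_var_expo)
    qed
    \<comment> \<open>Some \<open>k\<close> blocks the exchange of \<open>i\<close> for
      \<open>j\<close>. At \<open>u + var_expo k\<close> the unit at \<open>i\<close> therefore
      cannot move to \<open>j\<close>, so the closed set of sources of \<open>j\<close> avoids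
      \<open>i\<close> and belongs to \<open>T\<close>.\<close>
    have cover: "\<exists>A\<in>T. j \<in> A" if j: "Poly_Mapping.lookup u j < Poly_Mapping.lookup v j" for j
    proof -
      obtain k where k: "var_expo j + (u - var_expo i) + var_expo k \<notin> B" using no j by blast
      let ?b = "u + var_expo k"
      let ?D = "insert j {l. var_expo j + (?b - var_expo l) \<in> B}"
      have "?b \<in> B" using u by blast
      then have le: "weight b' ?D \<le> weight ?b ?D" if "b' \<in> B" for b'
        using weight_le_if_exchange_closed[OF B _ exchange_closed_reachable[OF B]] that by blast
      have "var_expo j + (u - var_expo i) + var_expo k = var_expo j + (?b - var_expo i)"
        using i by (intro poly_mapping_eqI) (auto simp: lookup_add lookup_minus lookup_single when_def)
      then have "i \<notin> ?D" using k i j by auto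
      moreover have "weight ?b ?D \<le> weight u ?D + 1" by (simp add: weight_add weight_var_expo)
      ultimately have "?D \<in> T" using le unfolding T_def by (auto intro: order_trans)
      then show ?thesis by blast
    qed
    define M where "M = {A\<in>T. \<forall>A'\<in>T. A \<subseteq> A' \<longrightarrow> A = A'}"
    have MI: "\<exists>A'\<in>M. A \<subseteq> A'" if A: "A \<in> T" for A
    proof -
      obtain A' where "A' \<in> T" "A \<subseteq> A'" "\<forall>A''\<in>T. A' \<subseteq> A'' \<longrightarrow> A' = A''"
        using finite_has_maximal2[OF \<open>finite T\<close> A] by metis
      then show ?thesis unfolding M_def by (intro bexI[of _ A']) simp_all
    qed
    have coverM: "j \<in> \<Union>M" if j: "Poly_Mapping.lookup u j < Poly_Mapping.lookup v j" for j
    proof -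
      obtain A where "A \<in> T" "j \<in> A" using cover[OF j] by metis
      then show ?thesis using MI by (metis UnionI subsetD)
    qed
    have disj: "A \<inter> A' = {}" if A: "A \<in> M" and A': "A' \<in> M" and ne: "A \<noteq> A'" for A A'
    proof (rule ccontr)
      assume "A \<inter> A' \<noteq> {}"
      then have "A \<union> A' \<in> T" using T_Un A A' by (simp add: M_def)
      then have "A = A \<union> A'" "A' = A \<union> A'" using A A' by (simp_all only: M_def mem_Collect_eq Un_upper1 Un_upper2)
      then show False using ne by metis
    qed
    have "weight w (\<Union>M) = (\<Sum>A\<in>M. weight w A)" for w
      unfolding weight_def by (subst sum.Union_disjoint) (blast intro: finite dest: disj | simp)+
    then have in_le: "weight v (\<Union>M) \<le> weight u (\<Union>M)"
      using T_le by (auto simp only: M_def intro!: sum_mono)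
    have "i \<in> - \<Union>M" unfolding M_def T_def by blast
    have "weight v (- \<Union>M) < weight u (- \<Union>M)"
      unfolding weight_def
    proof (rule sum_strict_mono_ex1)
      show "\<forall>x\<in>- \<Union>M. Poly_Mapping.lookup v x \<le> Poly_Mapping.lookup u x"
        using coverM by (metis ComplD not_le_imp_less)
      show "\<exists>x\<in>- \<Union>M. Poly_Mapping.lookup v x < Poly_Mapping.lookup u x"
        using \<open>i \<in> - \<Union>M\<close> i by (rule bexI[rotated])
    qed (rule finite)
    then have "mdeg v < mdeg u" using in_le by (simp add: mdeg_eq_weight[of _ "\<Union>M"])
    then show False using deg[OF v u] by simp
  qed
  with deg show ?thesis
    unfolding exchange_family_def by (intro conjI ballI allI impI)
qed

section \<open>The Koszul complex\<close>

abbreviation xvar :: "'x \<Rightarrow> ('x, 'k::comm_ring_1) mpol" where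
  "xvar i \<equiv> xmon (var_expo i)"

lemma lookup_single_mult_add:
  fixes f :: "('x, 'k::comm_ring_1) mpol"
  shows "Poly_Mapping.lookup (Poly_Mapping.single a c * f) (a + b) = c * Poly_Mapping.lookup f b"
  by (simp only: lookup_mult lookup_single when_mult Sum_any_when_equal' add_left_cancel)

lemma lookup_xvar_mult:
  fixes f :: "('x, 'k::comm_ring_1) mpol"
  shows "Poly_Mapping.lookup (xvar i * f) b =
    (if i \<in> Poly_Mapping.keys b then Poly_Mapping.lookup f (b - var_expo i) else 0)"
proof (cases "i \<in> Poly_Mapping.keys b")
  case True
  then have "b = var_expo i + (b - var_expo i)"
    using minus_var_expo_add[of b i] by (simp add: in_keys_iff add.commute)
  then show ?thesis
    using True lookup_single_mult_add[of "var_expo i" 1 f "b - var_expo i"] by (simp add: xmon_def)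
next
  case False
  have "b \<notin> Poly_Mapping.keys (xvar i * f)"
  proof
    assume "b \<in> Poly_Mapping.keys (xvar i * f)"
    then obtain c where "b = var_expo i + c"
      using keys_mult[of "xvar i" f] by (auto simp: xmon_def split: if_splits)
    then show False using False by (simp add: in_keys_iff lookup_add)
  qed
  then show ?thesis using False by (simp add: in_keys_iff)
qed

lemma lookup_neg_one_power_mult:
  fixes f :: "('x, 'k::comm_ring_1) mpol"
  shows "Poly_Mapping.lookup ((- 1) ^ n * f) b = (- 1) ^ n * Poly_Mapping.lookup f b"
  by (cases "even n") (simp_all only: minus_one_power_iff if_True if_False mult_1_left mult_minus_left lookup_uminus)

text \<open>This is the sign of sorting \<open>e_j\<close> into the wedge product
  \<open>e_T\<close>; \<open>to_nat\<close> only serves as a linear order on the variables.\<close>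

definition koszul_sign :: "'x::finite \<Rightarrow> 'x set \<Rightarrow> 'a::comm_ring_1" where
  "koszul_sign j T = (- 1) ^ card {t\<in>T. to_nat t < to_nat j}"

text \<open>
  A chain \<open>\<Sum>\<^sub>T \<phi> T e\<^sub>T\<close> of the Koszul complex is encoded as the function \<open>\<phi>\<close> on sets of variables;
  homological degree \<open>i\<close> only looks at \<open>T\<close> with \<open>card T = i\<close>.
\<close>

definition koszul_bd :: "('x set \<Rightarrow> ('x, 'k) mpol) \<Rightarrow> 'x::finite set \<Rightarrow> ('x, 'k::comm_ring_1) mpol" where
  "koszul_bd \<phi> T = (\<Sum>j\<in>- T. koszul_sign j T * xvar j * \<phi> (insert j T))"

lemma koszul_sign_insert:
  "i \<notin> T \<Longrightarrow> koszul_sign j (insert i T) = (if to_nat i < to_nat j then - 1 else 1) * koszul_sign j T"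
proof -
  assume "i \<notin> T"
  have "{t \<in> insert i T. to_nat t < to_nat j} =
      (if to_nat i < to_nat j then insert i {t\<in>T. to_nat t < to_nat j} else {t\<in>T. to_nat t < to_nat j})"
    by auto
  then show ?thesis using \<open>i \<notin> T\<close> by (simp add: koszul_sign_def)
qed

text \<open>Each pair of new variables is added in both orders, and the presence of the first
  changes the sign of the second in exactly one of them, so the two contributions cancel.\<close>

lemma koszul_bd_koszul_bd: "koszul_bd (koszul_bd \<phi>) T = 0"
proof -
  let ?f = "\<lambda>j l. koszul_sign j T * koszul_sign l (insert j T) * xvar j * xvar l * \<phi> (insert l (insert j T))"
  let ?P = "{(j, l). j \<notin> T \<and> l \<notin> T \<and> to_nat j < to_nat l}"
  let ?Q = "{(j, l). j \<notin> T \<and> l \<notin> T \<and> to_nat l < to_nat j}"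
  have "koszul_bd (koszul_bd \<phi>) T = (\<Sum>j\<in>- T. \<Sum>l\<in>- insert j T. ?f j l)"
    unfolding koszul_bd_def sum_distrib_left by (intro sum.cong refl) (simp only: mult_ac)
  also have "\<dots> = (\<Sum>(j, l)\<in>Sigma (- T) (\<lambda>j. - insert j T). ?f j l)"
    by (simp add: sum.Sigma)
  also have "Sigma (- T) (\<lambda>j. - insert j T) = ?P \<union> ?Q"
  proof -
    have "to_nat j < to_nat l \<or> to_nat l < to_nat j" if "l \<noteq> j" for j l :: 'a
      using that by (metis from_nat_to_nat linorder_neqE_nat)
    then show ?thesis by auto
  qed
  also have "(\<Sum>(j, l)\<in>?P \<union> ?Q. ?f j l) = (\<Sum>(j, l)\<in>?P. ?f j l) + (\<Sum>(j, l)\<in>?Q. ?f j l)"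
    by (rule sum.union_disjoint) auto
  also have "(\<Sum>(j, l)\<in>?Q. ?f j l) = (\<Sum>(l, j)\<in>?P. ?f j l)"
    by (rule sum.reindex_bij_witness[of _ prod.swap prod.swap]) (auto simp only: prod.swap_def mem_Collect_eq prod.case fst_conv snd_conv)
  also have "\<dots> = (\<Sum>(l, j)\<in>?P. - ?f l j)"
  proof (rule sum.cong[OF refl], clarify)
    fix j l assume jl: "j \<notin> T" "l \<notin> T" "to_nat j < to_nat l"
    have signs: "koszul_sign j (insert l T) = (koszul_sign j T :: ('a, 'b) mpol)"
      "koszul_sign l (insert j T) = (- koszul_sign l T :: ('a, 'b) mpol)"
      using jl by (simp_all add: koszul_sign_insert)
    have "insert l (insert j T) = insert j (insert l T)" by (rule insert_commute)
    then show "?f l j = - ?f j l" unfolding signs by (simp only: mult_minus_left mult_minus_right minus_minus mult_ac)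
  qed
  also have "(\<Sum>(l, j)\<in>?P. - ?f l j) = - (\<Sum>(j, l)\<in>?P. ?f j l)"
    by (simp only: sum_negf[symmetric] case_prod_unfold)
  finally show ?thesis by (simp only: add.right_inverse)
qed

section \<open>A contracting homotopy, one multidegree at a time\<close>

definition least_var :: "'x::finite set \<Rightarrow> 'x" where
  "least_var A = arg_min_on to_nat A"

lemma least_var:
  assumes "A \<noteq> {}"
  shows "least_var A \<in> A" "l \<in> A \<Longrightarrow> to_nat (least_var A) \<le> to_nat l"
  using arg_min_if_finite(1)[OF finite assms, of to_nat] arg_min_least[OF finite assms, of l to_nat]
  unfolding least_var_def by blast+

lemma least_varI:
  assumes "i \<in> A" "\<And>l. l \<in> A \<Longrightarrow> to_nat i \<le> to_nat l"
  shows "least_var A = i"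
proof -
  have "A \<noteq> {}" using assms(1) by blast
  then have "to_nat (least_var A) = to_nat i"
    using least_var assms by (intro antisym) blast+
  then show ?thesis by (simp only: inj_eq[OF inj_to_nat])
qed

text \<open>
  On the part of multidegree \<open>a\<close> this is \<open>e\<^sub>i \<and> _\<close> divided by \<open>x\<^sub>i\<close>, where \<open>i\<close> is the least element of
  the support of \<open>a\<close>; minimality makes all signs positive. It is linear over the coefficients only.
\<close>

definition koszul_homotopy ::
  "('x set \<Rightarrow> ('x, 'k) mpol) \<Rightarrow> 'x::finite set \<Rightarrow> ('x, 'k::comm_ring_1) mpol" where
  "koszul_homotopy \<phi> T =
     (let i = least_var T
      in if T = {} then 0
         else Poly_Mapping.mapp (\<lambda>b c. c when (\<forall>l\<in>Poly_Mapping.keys b. to_nat i \<le> to_nat l))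
                (Poly_Mapping.map_key (\<lambda>b. b + var_expo i) (\<phi> (T - {i}))))"

text \<open>The support of the multidegree of \<open>x^b e_T\<close> is
  \<open>keys b \<union> T\<close>. The definition only sees the least element of \<open>T\<close>
  and filters out those \<open>b\<close> that contain a smaller variable; here the result is
  expressed through the multidegree, which the differential preserves.\<close>

lemma lookup_koszul_homotopy:
  fixes \<phi> :: "'x::finite set \<Rightarrow> ('x, 'k::comm_ring_1) mpol"
  assumes "i = least_var (Poly_Mapping.keys b \<union> T)"
  shows "Poly_Mapping.lookup (koszul_homotopy \<phi> T) b =
    (if i \<in> T then Poly_Mapping.lookup (\<phi> (T - {i})) (b + var_expo i) else 0)"
proof (cases "T = {}")
  case True
  then show ?thesis by (simp add: koszul_homotopy_def)
next
  case False
  let ?k = "least_var T"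
  have inj: "inj (\<lambda>b :: 'x expo. b + var_expo ?k)" by (simp add: inj_def)
  have lk: "Poly_Mapping.lookup (koszul_homotopy \<phi> T) b =
    (if \<forall>l\<in>Poly_Mapping.keys b. to_nat ?k \<le> to_nat l
     then Poly_Mapping.lookup (\<phi> (T - {?k})) (b + var_expo ?k) else 0)"
    using False inj
    by (auto simp: koszul_homotopy_def Let_def lookup_mapp map_key.rep_eq in_keys_iff when_def)
  show ?thesis
  proof (cases "i \<in> T")
    case True
    then have "?k = i"
      using assms least_var(2)[of "Poly_Mapping.keys b \<union> T"] False by (intro least_varI) auto
    then show ?thesis
      using lk True assms least_var(2)[of "Poly_Mapping.keys b \<union> T"] False by auto
  next
    case F: False
    have "\<not> (\<forall>l\<in>Poly_Mapping.keys b. to_nat ?k \<le> to_nat l)"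
    proof
      assume "\<forall>l\<in>Poly_Mapping.keys b. to_nat ?k \<le> to_nat l"
      then have "least_var (Poly_Mapping.keys b \<union> T) = ?k"
        using least_var[OF False] by (intro least_varI) auto
      then show False using F least_var(1)[OF False] assms by simp
    qed
    then show ?thesis using lk F by presburger
  qed
qed

lemma lookup_koszul_bd:
  fixes \<phi> :: "'x::finite set \<Rightarrow> ('x, 'k::comm_ring_1) mpol"
  shows "Poly_Mapping.lookup (koszul_bd \<phi> T) b =
    (\<Sum>j\<in>Poly_Mapping.keys b - T. koszul_sign j T * Poly_Mapping.lookup (\<phi> (insert j T)) (b - var_expo j))"
proof -
  have "Poly_Mapping.lookup (koszul_bd \<phi> T) b =
    (\<Sum>j\<in>- T. koszul_sign j T * (if j \<in> Poly_Mapping.keys b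
       then Poly_Mapping.lookup (\<phi> (insert j T)) (b - var_expo j) else 0))"
    unfolding koszul_bd_def koszul_sign_def
    by (simp only: lookup_sum mult.assoc lookup_neg_one_power_mult lookup_xvar_mult)
  also have "\<dots> = (\<Sum>j\<in>Poly_Mapping.keys b - T. koszul_sign j T * Poly_Mapping.lookup (\<phi> (insert j T)) (b - var_expo j))"
    by (rule sum.mono_neutral_cong_right) auto
  finally show ?thesis .
qed

lemma keys_minus_var_expo_Un_insert:
  assumes "j \<in> Poly_Mapping.keys b"
  shows "Poly_Mapping.keys (b - var_expo j) \<union> insert j T = Poly_Mapping.keys b \<union> T"
proof (rule Set.set_eqI)
  fix l show "l \<in> Poly_Mapping.keys (b - var_expo j) \<union> insert j T \<longleftrightarrow> l \<in> Poly_Mapping.keys b \<union> T"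
  using assms by (cases "l = j") (simp_all add: in_keys_iff lookup_minus lookup_single when_def )
qed

lemma keys_plus_var_expo: "Poly_Mapping.keys (b + var_expo i) = insert i (Poly_Mapping.keys b)"
proof (rule Set.set_eqI)
  fix l show "l \<in> Poly_Mapping.keys (b + var_expo i) \<longleftrightarrow> l \<in> insert i (Poly_Mapping.keys b)"
    by (cases "l = i") (simp_all add: in_keys_iff lookup_add lookup_single when_def)
qed

text \<open>Let \<open>i\<close> be the least variable of the multidegree. If
  \<open>i \<notin> T\<close>, the second summand vanishes and only \<open>j = i\<close> survives in
  the first. If \<open>i \<in> T\<close>, the two sums cancel term by term except for
  \<open>j = i\<close> in the second. The correction on the right is the multidegree 0 part, which
  is the homology \<open>K\<close>.\<close>

lemma koszul_homotopy_identity: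
  fixes \<phi> :: "'x::finite set \<Rightarrow> ('x, 'k::comm_ring_1) mpol"
  shows "koszul_bd (koszul_homotopy \<phi>) T + koszul_homotopy (koszul_bd \<phi>) T =
    \<phi> T - (if T = {} then Poly_Mapping.single 0 (Poly_Mapping.lookup (\<phi> T) 0) else 0)"
proof (rule poly_mapping_eqI)
  fix b
  let ?L = "Poly_Mapping.lookup (koszul_bd (koszul_homotopy \<phi>) T) b"
  let ?R = "Poly_Mapping.lookup (koszul_homotopy (koszul_bd \<phi>) T) b"
  define i where "i = least_var (Poly_Mapping.keys b \<union> T)"
  have R: "?R = (if i \<in> T then Poly_Mapping.lookup (koszul_bd \<phi> (T - {i})) (b + var_expo i) else 0)"
    by (rule lookup_koszul_homotopy) (simp add: i_def)
  have L: "?L = (\<Sum>j\<in>Poly_Mapping.keys b - T. koszul_sign j T *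
      (if i \<in> insert j T then Poly_Mapping.lookup (\<phi> (insert j T - {i})) (b - var_expo j + var_expo i) else 0))"
    unfolding lookup_koszul_bd
    by (intro sum.cong refl, subst lookup_koszul_homotopy[of i])
       (auto simp: i_def keys_minus_var_expo_Un_insert simp del: Un_insert_right)
  have "?L + ?R = Poly_Mapping.lookup (\<phi> T) b - (if T = {} \<and> b = 0 then Poly_Mapping.lookup (\<phi> T) 0 else 0)"
  proof (cases "Poly_Mapping.keys b \<union> T = {}")
    case True
    then show ?thesis using L R by simp
  next
    case False
    have i: "i \<in> Poly_Mapping.keys b \<union> T" "\<And>l. l \<in> Poly_Mapping.keys b \<union> T \<Longrightarrow> to_nat i \<le> to_nat l"
      using least_var[OF False] by (simp_all add: i_def)
    have nz: "\<not> (T = {} \<and> b = 0)" using False by auto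
    show ?thesis
    proof (cases "i \<in> T")
      case False
      have ib: "i \<in> Poly_Mapping.keys b" using i False by blast
      have "?L = (\<Sum>j\<in>{i}. koszul_sign j T *
          (if i \<in> insert j T then Poly_Mapping.lookup (\<phi> (insert j T - {i})) (b - var_expo j + var_expo i) else 0))"
        unfolding L using ib False by (intro sum.mono_neutral_right) auto
      also have "\<dots> = koszul_sign i T * Poly_Mapping.lookup (\<phi> T) b"
        using False ib minus_var_expo_add[of b i] by (simp add: in_keys_iff)
      also have "koszul_sign i T = (1 :: 'k)"
      proof -
        have "{t\<in>T. to_nat t < to_nat i} = {}" using i(2) by (auto simp: not_less)
        then show ?thesis by (simp only: koszul_sign_def card.empty power_0)
      qed
      finally show ?thesis using R False nz by (simp only: if_False simp_thms mult_1_left diff_0_right add_0_right)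
    next
      case True
      have keys: "Poly_Mapping.keys (b + var_expo i) - (T - {i}) = insert i (Poly_Mapping.keys b - T)"
        using True by (auto simp: keys_plus_var_expo)
      have "?R = (\<Sum>j\<in>insert i (Poly_Mapping.keys b - T). koszul_sign j (T - {i}) *
          Poly_Mapping.lookup (\<phi> (insert j (T - {i}))) (b + var_expo i - var_expo j))"
        using R True by (simp only: if_True lookup_koszul_bd keys)
      also have "\<dots> = koszul_sign i (T - {i}) * Poly_Mapping.lookup (\<phi> T) b +
        (\<Sum>j\<in>Poly_Mapping.keys b - T. koszul_sign j (T - {i}) *
          Poly_Mapping.lookup (\<phi> (insert j (T - {i}))) (b + var_expo i - var_expo j))"
        using True insert_absorb[OF True] by (subst sum.insert) (simp_all only: finite_Diff finite_keys Diff_iff simp_thms insert_Diff_single add_diff_cancel_right')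
      also have "koszul_sign i (T - {i}) = (1 :: 'k)"
      proof -
        have "{t\<in>T - {i}. to_nat t < to_nat i} = {}" using i(2) by (auto simp: not_less)
        then show ?thesis by (simp only: koszul_sign_def card.empty power_0)
      qed
      also have "(\<Sum>j\<in>Poly_Mapping.keys b - T. koszul_sign j (T - {i}) *
          Poly_Mapping.lookup (\<phi> (insert j (T - {i}))) (b + var_expo i - var_expo j)) = - ?L"
        unfolding L sum_negf[symmetric]
      proof (rule sum.cong)
        fix j assume j: "j \<in> Poly_Mapping.keys b - T"
        then have "j \<noteq> i" "to_nat i \<le> to_nat j" using True i(2) by auto
        then have "to_nat i < to_nat j" using le_neq_implies_less by fastforce
        then have "koszul_sign j T = (- koszul_sign j (T - {i}) :: 'k)"
          using koszul_sign_insert[of i "T - {i}" j] True insert_Diff[OF True] by simp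
        moreover have "b + var_expo i - var_expo j = b - var_expo j + var_expo i"
        proof -
          have "b - var_expo j + var_expo j = b"
            using j by (intro minus_var_expo_add) (simp add: in_keys_iff)
          then have "b + var_expo i = (b - var_expo j + var_expo i) + var_expo j"
            by (metis add.assoc add.commute)
          then show ?thesis using add_diff_cancel_right' by (rule trans[OF arg_cong[where f = "\<lambda>c. c - var_expo j"]])
        qed
        moreover have "insert j T - {i} = insert j (T - {i})" using \<open>j \<noteq> i\<close> by auto
        ultimately show "koszul_sign j (T - {i}) *
          Poly_Mapping.lookup (\<phi> (insert j (T - {i}))) (b + var_expo i - var_expo j) =
          - (koszul_sign j T * (if i \<in> insert j T
            then Poly_Mapping.lookup (\<phi> (insert j T - {i})) (b - var_expo j + var_expo i) else 0))"
          using True by simp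
      qed simp
      finally show ?thesis using nz by (simp only: if_False mult_1_left) simp
    qed
  qed
  then show "Poly_Mapping.lookup (koszul_bd (koszul_homotopy \<phi>) T + koszul_homotopy (koszul_bd \<phi>) T) b =
    Poly_Mapping.lookup (\<phi> T - (if T = {} then Poly_Mapping.single 0 (Poly_Mapping.lookup (\<phi> T) 0) else 0)) b"
    by (auto simp: lookup_add lookup_minus lookup_single when_def)
qed

section \<open>Homogeneous polynomials\<close>

lemma homogeneous_0 [simp]: "homogeneous d 0"
  by (simp add: homogeneous_def)

lemma homogeneous_add:
  fixes f g :: "('x::finite, 'k::comm_monoid_add) mpol"
  shows "homogeneous d f \<Longrightarrow> homogeneous d g \<Longrightarrow> homogeneous d (f + g)"
  using Poly_Mapping.keys_add[of f g] unfolding homogeneous_def by blast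

lemma homogeneous_sum:
  fixes f :: "'a \<Rightarrow> ('x::finite, 'k::comm_monoid_add) mpol"
  assumes "\<And>a. a \<in> A \<Longrightarrow> homogeneous d (f a)"
  shows "homogeneous d (sum f A)"
  using assms by (induction A rule: infinite_finite_induct) (auto intro: homogeneous_add)

lemma homogeneous_mult:
  fixes f g :: "('x::finite, 'k::comm_ring_1) mpol"
  assumes "homogeneous c f" "homogeneous d g"
  shows "homogeneous (c + d) (f * g)"
  unfolding homogeneous_def
proof
  fix a assume "a \<in> Poly_Mapping.keys (f * g)"
  then obtain p q where "a = p + q" "p \<in> Poly_Mapping.keys f" "q \<in> Poly_Mapping.keys g"
    using keys_mult[of f g] by blast
  then show "int (mdeg a) = c + d" using assms by (simp add: homogeneous_def mdeg_add)
qed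

lemma homogeneous_koszul_sign:
  "homogeneous 0 (koszul_sign j T :: ('x::finite, 'k::comm_ring_1) mpol)"
proof -
  have "homogeneous 0 (1 :: ('x, 'k) mpol)" by (simp add: homogeneous_def)
  moreover have "homogeneous 0 (- 1 :: ('x, 'k) mpol)"
    by (simp add: homogeneous_def in_keys_iff lookup_one when_def)
  ultimately show ?thesis by (simp add: koszul_sign_def minus_one_power_iff)
qed

lemma homogeneous_xmon: "homogeneous (int (mdeg a)) (xmon a :: ('x::finite, 'k::comm_ring_1) mpol)"
  by (simp add: homogeneous_def xmon_def)

lemma homogeneous_sign_xvar_mult:
  fixes f :: "('x::finite, 'k::comm_ring_1) mpol"
  assumes "homogeneous (d - 1) f"
  shows "homogeneous d (koszul_sign j T * xvar j * f)"
  using homogeneous_mult[OF homogeneous_mult[OF homogeneous_koszul_sign homogeneous_xmon[of "var_expo j"]] assms] by simp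

section \<open>The Koszul complex in matrix form, and its exactness\<close>

definition subset_enum :: "nat \<Rightarrow> nat \<Rightarrow> 'x::finite set" where
  "subset_enum i = (SOME h. bij_betw h {0..<card {T :: 'x set. card T = i}} {T. card T = i})"

lemma bij_betw_subset_enum:
  "bij_betw (subset_enum i) {0..<card {T :: 'x::finite set. card T = i}} {T :: 'x set. card T = i}"
  using someI_ex[OF ex_bij_betw_nat_finite[OF finite, of "{T :: 'x set. card T = i}"]]
  unfolding subset_enum_def .

text \<open>The arbitrary numbering \<open>subset_enum\<close> supplies matrix indices. Each entry
  of \<open>bd\<close> is a sum with at most one nonzero term, since the larger set determines the
  added variable \<open>j\<close>. All basis elements \<open>e_T\<close> with
  \<open>card T = i\<close> have degree \<open>i\<close>.\<close>

definition koszul_complex :: "('x::finite, 'k::comm_ring_1) free_complex" where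
  "koszul_complex =
    \<lparr>rnk = (\<lambda>i. card {T :: 'x set. card T = i}),
     shift = (\<lambda>i b. int i),
     bd = (\<lambda>i. mat (card {T :: 'x set. card T = i}) (card {T :: 'x set. card T = Suc i})
       (\<lambda>(p, q). \<Sum>j\<in>- subset_enum i p.
          if subset_enum (Suc i) q = insert j (subset_enum i p) then koszul_sign j (subset_enum i p) * xvar j else 0)),
     aug = vec (card {T :: 'x set. card T = 0}) (\<lambda>_. 1)\<rparr>"

definition koszul_vec :: "nat \<Rightarrow> ('x::finite set \<Rightarrow> ('x, 'k::comm_ring_1) mpol) \<Rightarrow> ('x, 'k) mpol vec" where
  "koszul_vec i \<phi> = vec (card {T :: 'x set. card T = i}) (\<lambda>p. \<phi> (subset_enum i p))"

lemma dim_koszul_vec [simp]: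
  "dim_vec (koszul_vec i (\<phi> :: 'x::finite set \<Rightarrow> ('x, 'k::comm_ring_1) mpol)) = card {T :: 'x set. card T = i}"
  by (simp add: koszul_vec_def)

lemma koszul_vec_carrier [simp]:
  fixes \<phi> :: "'x::finite set \<Rightarrow> ('x, 'k::comm_ring_1) mpol"
  shows "koszul_vec i \<phi> \<in> carrier_vec (rnk (koszul_complex :: ('x, 'k) free_complex) i)"
  unfolding koszul_vec_def koszul_complex_def by (simp only: free_complex.simps vec_carrier)

lemma subset_enum_ball:
  "(\<forall>p<card {T :: 'x::finite set. card T = i}. P (subset_enum i p :: 'x set)) \<longleftrightarrow> (\<forall>T. card T = i \<longrightarrow> P T)"
proof -
  let ?A = "{0..<card {T :: 'x set. card T = i}}"
  have "(\<forall>p<card {T :: 'x set. card T = i}. P (subset_enum i p)) \<longleftrightarrow> (\<forall>T\<in>subset_enum i ` ?A. P T)"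
    by auto
  also have "subset_enum i ` ?A = {T :: 'x set. card T = i}"
    using bij_betw_subset_enum by (rule bij_betw_imp_surj_on)
  finally show ?thesis by simp
qed

lemma koszul_vec_eq_iff:
  "koszul_vec i \<phi> = koszul_vec i \<psi> \<longleftrightarrow> (\<forall>T. card T = i \<longrightarrow> \<phi> T = \<psi> T)"
  unfolding subset_enum_ball[where P = "\<lambda>T. \<phi> T = \<psi> T", symmetric]
  unfolding koszul_vec_def vec_eq_iff by simp

lemma koszul_vec_0:
  "koszul_vec i (\<lambda>_ :: 'x::finite set. 0 :: ('x, 'k::comm_ring_1) mpol) =
    0\<^sub>v (rnk (koszul_complex :: ('x, 'k) free_complex) i)"
  unfolding koszul_vec_def koszul_complex_def by (rule eq_vecI) simp_all

lemma koszul_vec_cases: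
  fixes v :: "('x::finite, 'k::comm_ring_1) mpol vec"
  assumes "v \<in> carrier_vec (rnk (koszul_complex :: ('x, 'k) free_complex) i)"
  obtains \<phi> where "v = koszul_vec i \<phi>"
proof
  let ?inv = "inv_into {0..<card {T :: 'x set. card T = i}} (subset_enum i)"
  show "v = koszul_vec i (\<lambda>T. v $ ?inv T)"
    using assms bij_betw_imp_inj_on[OF bij_betw_subset_enum[where 'x = 'x, of i]]
    by (intro eq_vecI) (auto simp: koszul_vec_def koszul_complex_def inv_into_f_f)
qed

lemma bd_koszul_vec:
  fixes \<phi> :: "'x::finite set \<Rightarrow> ('x, 'k::comm_ring_1) mpol"
  shows "bd koszul_complex i *\<^sub>v koszul_vec (Suc i) \<phi> = koszul_vec i (koszul_bd \<phi>)"
proof (rule eq_vecI)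
  fix p assume "p < dim_vec (koszul_vec i (koszul_bd \<phi>))"
  then have p: "p < card {T :: 'x set. card T = i}" by simp
  define T :: "'x set" where "T = subset_enum i p"
  have T: "card T = i"
    using bij_betw_apply[OF bij_betw_subset_enum, of p i] p by (simp add: T_def)
  let ?c = "\<lambda>U j. if U = insert j T then koszul_sign j T * xvar j else (0 :: ('x, 'k) mpol)"
  have "(bd koszul_complex i *\<^sub>v koszul_vec (Suc i) \<phi>) $ p =
    (\<Sum>q\<in>{0..<card {T :: 'x set. card T = Suc i}}. (\<Sum>j\<in>- T. ?c (subset_enum (Suc i) q) j) * \<phi> (subset_enum (Suc i) q))"
    unfolding T_def using p by (simp add: koszul_complex_def scalar_prod_def koszul_vec_def)
  also have "\<dots> = (\<Sum>U\<in>{U. card U = Suc i}. (\<Sum>j\<in>- T. ?c U j) * \<phi> U)"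
    by (rule sum.reindex_bij_betw[OF bij_betw_subset_enum])
  also have "\<dots> = (\<Sum>j\<in>- T. \<Sum>U\<in>{U. card U = Suc i}. ?c U j * \<phi> U)"
    unfolding sum_distrib_right by (rule sum.swap)
  also have "\<dots> = koszul_bd \<phi> T"
    unfolding koszul_bd_def
  proof (rule sum.cong[OF refl])
    fix j assume j: "j \<in> - T"
    have "(\<Sum>U\<in>{U. card U = Suc i}. ?c U j * \<phi> U) =
      (\<Sum>U\<in>{U. card U = Suc i}. if U = insert j T then koszul_sign j T * xvar j * \<phi> U else 0)"
      by (rule sum.cong) auto
    also have "\<dots> = koszul_sign j T * xvar j * \<phi> (insert j T)"
      using j T by (subst sum.delta) auto
    finally show "(\<Sum>U\<in>{U. card U = Suc i}. ?c U j * \<phi> U) = koszul_sign j T * xvar j * \<phi> (insert j T)" .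
  qed
  finally show "(bd koszul_complex i *\<^sub>v koszul_vec (Suc i) \<phi>) $ p = koszul_vec i (koszul_bd \<phi>) $ p"
    using p by (simp add: koszul_vec_def T_def)
qed (simp add: koszul_complex_def)

lemma koszul_homotopy_eq_0:
  fixes \<phi> :: "'x::finite set \<Rightarrow> ('x, 'k::comm_ring_1) mpol"
  assumes "\<And>i. i \<in> T \<Longrightarrow> \<phi> (T - {i}) = 0"
  shows "koszul_homotopy \<phi> T = 0"
  using assms by (intro poly_mapping_eqI) (simp add: lookup_koszul_homotopy[OF refl])

text \<open>The homotopy at \<open>T\<close> reads its argument only on sets with one element fewer,
  where the cycle condition makes it vanish; the homotopy identity then exhibits a preimage.\<close>

lemma koszul_exact:
  fixes \<phi> :: "'x::finite set \<Rightarrow> ('x, 'k::comm_ring_1) mpol"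
  assumes "\<And>T. card T = i \<Longrightarrow> koszul_bd \<phi> T = 0" and "card T = Suc i"
  shows "koszul_bd (koszul_homotopy \<phi>) T = \<phi> T"
proof -
  have "koszul_homotopy (koszul_bd \<phi>) T = 0"
    using assms by (intro koszul_homotopy_eq_0) simp
  moreover have "T \<noteq> {}" using assms(2) by auto
  ultimately show ?thesis using koszul_homotopy_identity[of \<phi> T] by simp
qed

lemma koszul_exact_0:
  fixes \<phi> :: "'x::finite set \<Rightarrow> ('x, 'k::comm_ring_1) mpol"
  assumes "Poly_Mapping.lookup (\<phi> {}) 0 = 0"
  shows "koszul_bd (koszul_homotopy \<phi>) {} = \<phi> {}"
  using koszul_homotopy_identity[of \<phi> "{}"] assms koszul_homotopy_eq_0[of "{}" "koszul_bd \<phi>"] by simp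

lemma aug_map_koszul_vec:
  fixes \<phi> :: "'x::finite set \<Rightarrow> ('x, 'k::comm_ring_1) mpol"
  shows "aug_map koszul_complex (koszul_vec 0 \<phi>) = Poly_Mapping.lookup (\<phi> {}) 0"
proof -
  have "(\<forall>p<card {T :: 'x set. card T = 0}. subset_enum 0 p = ({} :: 'x set))"
    by (subst subset_enum_ball) simp
  then show ?thesis
    by (simp add: aug_map_def koszul_complex_def scalar_prod_def koszul_vec_def)
qed

text \<open>Vanishing of Tor is quantified over all free resolutions of \<open>K\<close>; this
  instance is what turns the hypothesis on \<open>I\<close> into statements about Koszul
  chains.\<close>

lemma free_resolution_koszul_complex:
  "free_resolution_of_K (koszul_complex :: ('x::finite, 'k::comm_ring_1) free_complex)"
proof -
  let ?F = "koszul_complex :: ('x, 'k) free_complex"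
  have "homogeneous (shift ?F (Suc i) q - shift ?F i p) (bd ?F i $$ (p, q))"
    if "p < rnk ?F i" "q < rnk ?F (Suc i)" for i p q
  proof -
    have "homogeneous 1 (koszul_sign j T * xvar j :: ('x, 'k) mpol)" for j T
      using homogeneous_mult[OF homogeneous_koszul_sign homogeneous_xmon[of "var_expo j"]] by simp
    then show ?thesis using that by (auto simp: koszul_complex_def intro!: homogeneous_sum)
  qed
  moreover have "aug_map ?F ` carrier_vec (rnk ?F 0) = UNIV"
  proof (rule subset_antisym[OF subset_UNIV], rule subsetI)
    fix c :: 'k
    have "c = aug_map ?F (koszul_vec 0 (\<lambda>_. Poly_Mapping.single 0 c))" by (simp add: aug_map_koszul_vec)
    then show "c \<in> aug_map ?F ` carrier_vec (rnk ?F 0)" using koszul_vec_carrier by (rule image_eqI)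
  qed
  moreover have "{v \<in> carrier_vec (rnk ?F 0). aug_map ?F v = 0} =
       (\<lambda>w. bd ?F 0 *\<^sub>v w) ` carrier_vec (rnk ?F 1)" (is "?Z = ?B")
  proof (rule subset_antisym; rule subsetI)
    fix v assume "v \<in> ?Z"
    then obtain \<phi> where v: "v = koszul_vec 0 \<phi>" and "Poly_Mapping.lookup (\<phi> {}) 0 = 0"
      by (auto simp: aug_map_koszul_vec elim: koszul_vec_cases)
    then have "v = koszul_vec 0 (koszul_bd (koszul_homotopy \<phi>))"
      by (auto simp: koszul_vec_eq_iff koszul_exact_0)
    then have "v = bd ?F 0 *\<^sub>v koszul_vec (Suc 0) (koszul_homotopy \<phi>)" by (simp only: bd_koszul_vec)
    then show "v \<in> ?B" unfolding One_nat_def using koszul_vec_carrier by (rule image_eqI)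
  next
    fix v assume "v \<in> ?B"
    then obtain \<phi> where "v = bd ?F 0 *\<^sub>v koszul_vec (Suc 0) \<phi>"
      unfolding One_nat_def by (auto elim: koszul_vec_cases)
    then have "v = koszul_vec 0 (koszul_bd \<phi>)" by (simp only: bd_koszul_vec)
    then show "v \<in> ?Z" by (simp add: aug_map_koszul_vec lookup_koszul_bd)
  qed
  moreover have "{v \<in> carrier_vec (rnk ?F (Suc i)). bd ?F i *\<^sub>v v = 0\<^sub>v (rnk ?F i)} =
       (\<lambda>w. bd ?F (Suc i) *\<^sub>v w) ` carrier_vec (rnk ?F (Suc (Suc i)))" (is "?Z = ?B") for i
  proof (rule subset_antisym; rule subsetI)
    fix v assume "v \<in> ?Z"
    then obtain \<phi> where v: "v = koszul_vec (Suc i) \<phi>" and "koszul_vec i (koszul_bd \<phi>) = koszul_vec i (\<lambda>_. 0)"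
      by (auto simp: bd_koszul_vec koszul_vec_0 elim: koszul_vec_cases)
    then have "v = koszul_vec (Suc i) (koszul_bd (koszul_homotopy \<phi>))"
      by (auto simp: koszul_vec_eq_iff intro: koszul_exact[symmetric])
    then have "v = bd ?F (Suc i) *\<^sub>v koszul_vec (Suc (Suc i)) (koszul_homotopy \<phi>)"
      by (simp only: bd_koszul_vec)
    then show "v \<in> ?B" using koszul_vec_carrier by (rule image_eqI)
  next
    fix v assume "v \<in> ?B"
    then obtain \<phi> where "v = bd ?F (Suc i) *\<^sub>v koszul_vec (Suc (Suc i)) \<phi>"
      by (auto elim: koszul_vec_cases)
    then have "v = koszul_vec (Suc i) (koszul_bd \<phi>)" by (simp only: bd_koszul_vec)
    then show "v \<in> ?Z" by (simp add: bd_koszul_vec koszul_bd_koszul_bd[abs_def] koszul_vec_0)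
  qed
  ultimately show ?thesis
    unfolding free_resolution_of_K_def by (auto simp: koszul_complex_def)
qed

section \<open>Tor at the two ends of the Koszul complex\<close>

lemma koszul_vec_in_tensor_part:
  "koszul_vec i \<phi> \<in> tensor_part koszul_complex L i k \<longleftrightarrow>
    (\<forall>T. card T = i \<longrightarrow> \<phi> T \<in> L \<and> homogeneous (k - int i) (\<phi> T))"
  unfolding subset_enum_ball[where P = "\<lambda>T. \<phi> T \<in> L \<and> homogeneous (k - int i) (\<phi> T)", symmetric]
  by (auto simp: tensor_part_def koszul_complex_def koszul_vec_def)

lemma tor_vanishes_koszul:
  fixes I :: "('x::finite, 'k::comm_ring_1) mpol set"
  assumes "tor_vanishes i k I" "koszul_vec i \<phi> \<in> tor_cycles koszul_complex I i k"
  obtains \<psi> where "\<And>T. card T = i \<Longrightarrow> \<phi> T = koszul_bd \<psi> T"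
    and "\<And>T. card T = Suc i \<Longrightarrow> \<psi> T \<in> I"
    and "\<And>T. card T = Suc i \<Longrightarrow> homogeneous (k - int (Suc i)) (\<psi> T)"
proof -
  have "koszul_vec i \<phi> \<in> tor_boundaries koszul_complex I i k"
    using assms free_resolution_koszul_complex unfolding tor_vanishes_def by blast
  then obtain w where w: "w \<in> tensor_part koszul_complex I (Suc i) k"
    and eq: "koszul_vec i \<phi> = bd koszul_complex i *\<^sub>v w"
    unfolding tor_boundaries_def by blast
  have "w \<in> carrier_vec (rnk (koszul_complex :: ('x, 'k) free_complex) (Suc i))"
    using w by (simp add: tensor_part_def)
  then obtain \<psi> where \<psi>: "w = koszul_vec (Suc i) \<psi>" by (rule koszul_vec_cases)
  show thesis
    using eq w that[of \<psi>] by (simp add: \<psi> bd_koszul_vec koszul_vec_eq_iff koszul_vec_in_tensor_part)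
qed

text \<open>\<open>Tor_0(K, I)\<close> is \<open>I / \<mm>I\<close>, so its vanishing in degree
  \<open>k\<close> excludes minimal generators of that degree. The cofactors \<open>w j\<close> are
  the coefficients of a bounding chain on singletons.\<close>

lemma tor_0_vanishes_imp:
  fixes I :: "('x::finite, 'k::comm_ring_1) mpol set"
  assumes "tor_vanishes 0 k I" "f \<in> I" "homogeneous k f"
  obtains w where "f = (\<Sum>j\<in>UNIV. xvar j * w j)" "\<And>j. w j \<in> I" "\<And>j. homogeneous (k - 1) (w j)"
proof -
  have "koszul_vec 0 (\<lambda>_. f) \<in> tor_cycles koszul_complex I 0 k"
    using assms by (simp add: tor_cycles_def koszul_vec_in_tensor_part)
  with assms(1) obtain \<psi> where \<psi>: "\<And>T. card T = 0 \<Longrightarrow> f = koszul_bd \<psi> T"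
    "\<And>T. card T = Suc 0 \<Longrightarrow> \<psi> T \<in> I" "\<And>T. card T = Suc 0 \<Longrightarrow> homogeneous (k - int (Suc 0)) (\<psi> T)"
    by (rule tor_vanishes_koszul) blast
  have "f = (\<Sum>j\<in>UNIV. xvar j * \<psi> {j})"
    using \<psi>(1)[of "{}"] by (simp add: koszul_bd_def koszul_sign_def)
  then show thesis using \<psi>(2,3) by (intro that[of "\<lambda>j. \<psi> {j}"]) simp_all
qed

lemma xvar_mult_cancel:
  fixes f g :: "('x, 'k::comm_ring_1) mpol"
  assumes "xvar j * f = xvar j * g"
  shows "f = g"
proof (rule poly_mapping_eqI)
  fix b
  have "Poly_Mapping.lookup (xvar j * f) (var_expo j + b) = Poly_Mapping.lookup (xvar j * g) (var_expo j + b)"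
    using assms by simp
  then show "Poly_Mapping.lookup f b = Poly_Mapping.lookup g b"
    by (simp add: xmon_def lookup_single_mult_add)
qed

lemma koszul_sign_square: "koszul_sign j T * koszul_sign j T = 1"
  by (simp add: koszul_sign_def minus_one_power_iff)

text \<open>
  The chain \<open>f e\<^sub>T\<close> with \<open>T\<close> the set of all variables need not have its coefficient in \<open>I\<close>, but its
  boundary does.
\<close>

lemma tor_top_vanishes_imp:
  fixes I :: "('x::finite, 'k::comm_ring_1) mpol set"
  assumes I: "ideal.subspace I" and tor: "tor_vanishes i (int i + (d + 1)) I" and i: "card (UNIV :: 'x set) = Suc i"
    and f: "homogeneous d f" and mf: "\<And>j. xvar j * f \<in> I"
  shows "f \<in> I"
proof -
  define \<phi> where "\<phi> T = (if T = (UNIV :: 'x set) then f else 0)" for T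
  have xvar_\<phi>: "xvar j * \<phi> T \<in> I" for j T
    using mf ideal.subspace_0[OF I] by (simp add: \<phi>_def)
  have "koszul_bd \<phi> T \<in> I" for T
    unfolding koszul_bd_def mult.assoc
    by (rule ideal.subspace_sum[OF I], rule ideal.subspace_scale[OF I], rule xvar_\<phi>)
  moreover have "homogeneous (d + 1) (koszul_bd \<phi> T)" for T
    unfolding koszul_bd_def using f
    by (intro homogeneous_sum, intro homogeneous_sign_xvar_mult) (simp add: \<phi>_def)
  ultimately have "koszul_vec i (koszul_bd \<phi>) \<in> tensor_part koszul_complex I i (int i + (d + 1))"
    by (simp add: koszul_vec_in_tensor_part)
  moreover have "bd koszul_complex i' *\<^sub>v koszul_vec (Suc i') (koszul_bd \<phi>) =
      0\<^sub>v (rnk (koszul_complex :: ('x, 'k) free_complex) i')" for i'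
    unfolding bd_koszul_vec koszul_vec_0[symmetric] koszul_vec_eq_iff by (simp add: koszul_bd_koszul_bd)
  ultimately have "koszul_vec i (koszul_bd \<phi>) \<in> tor_cycles koszul_complex I i (int i + (d + 1))"
    by (auto simp: tor_cycles_def)
  with tor obtain \<psi> where \<psi>: "\<And>T. card T = i \<Longrightarrow> koszul_bd \<phi> T = koszul_bd \<psi> T"
    "\<And>T. card T = Suc i \<Longrightarrow> \<psi> T \<in> I"
    by (rule tor_vanishes_koszul) blast
  \<comment> \<open>Any variable will do: only \<open>j\<close> can be added to its complement, so
    both boundaries have a single term there, and sign and variable cancel.\<close>
  fix j :: 'x
  let ?T = "- {j}"
  have UNIV_eq: "insert j ?T = UNIV" by blast
  have "card ?T = i" using i by (simp add: Compl_eq_Diff_UNIV card_Diff_singleton)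
  then have "koszul_bd \<phi> ?T = koszul_bd \<psi> ?T" by (rule \<psi>(1))
  then have "koszul_sign j ?T * (xvar j * f) = koszul_sign j ?T * (xvar j * \<psi> UNIV)"
    unfolding koszul_bd_def by (simp only: double_complement sum.insert sum.empty finite.emptyI empty_iff simp_thms UNIV_eq \<phi>_def if_True mult.assoc add_0_right)
  then have "koszul_sign j ?T * (koszul_sign j ?T * (xvar j * f)) =
      koszul_sign j ?T * (koszul_sign j ?T * (xvar j * \<psi> UNIV))" by simp
  then have "xvar j * f = xvar j * \<psi> UNIV"
    by (simp only: mult.assoc[symmetric] koszul_sign_square mult_1_left)
  then have "f = \<psi> UNIV" by (rule xvar_mult_cancel)
  then show ?thesis using \<psi>(2)[of UNIV] i by simp
qed

section \<open>Monomial ideals and socles\<close>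

lemma expo_le_iff: "(\<exists>c. a = b + c) \<longleftrightarrow> (\<forall>l. Poly_Mapping.lookup b l \<le> Poly_Mapping.lookup a l)"
  for a b :: "'x expo"
proof
  assume "\<forall>l. Poly_Mapping.lookup b l \<le> Poly_Mapping.lookup a l"
  then have "a = b + (a - b)" by (intro poly_mapping_eqI) (simp add: lookup_add lookup_minus)
  then show "\<exists>c. a = b + c" by blast
qed (auto simp: lookup_add)

text \<open>A generator \<open>h i\<close> dividing \<open>x^u\<close> times the variable
  \<open>i\<close> but not \<open>x^u\<close> exceeds \<open>u\<close> exactly at \<open>i\<close>,
  and by one. If the degree of \<open>u\<close> were not smaller, \<open>h i\<close> would fall
  short of \<open>u\<close> at some \<open>k\<close>; exchanging its surplus unit at
  \<open>i\<close> against \<open>h k\<close> then gives a generator dividing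
  \<open>x^u\<close>.\<close>

lemma mdeg_socle_less:
  assumes B: "exchange_family B" and g: "g \<in> B"
    and u: "\<And>b. b \<in> B \<Longrightarrow> \<exists>l. Poly_Mapping.lookup b l > Poly_Mapping.lookup u l"
    and mu: "\<And>i. \<exists>b\<in>B. \<forall>l. Poly_Mapping.lookup b l \<le> Poly_Mapping.lookup (u + var_expo i) l"
  shows "mdeg u < mdeg g"
proof (rule ccontr)
  assume deg: "\<not> mdeg u < mdeg g"
  have "\<exists>b\<in>B. Poly_Mapping.lookup b i = Suc (Poly_Mapping.lookup u i) \<and>
      (\<forall>l. l \<noteq> i \<longrightarrow> Poly_Mapping.lookup b l \<le> Poly_Mapping.lookup u l)" for i
  proof -
    obtain b where b: "b \<in> B" "\<And>l. Poly_Mapping.lookup b l \<le> Poly_Mapping.lookup (u + var_expo i) l"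
      using mu[of i] by blast
    have le: "Poly_Mapping.lookup b l \<le> Poly_Mapping.lookup u l" if "l \<noteq> i" for l
      using b(2)[of l] that by (simp add: lookup_add lookup_single when_def)
    moreover obtain l where "Poly_Mapping.lookup b l > Poly_Mapping.lookup u l" using u[OF b(1)] by blast
    ultimately have "Poly_Mapping.lookup b i > Poly_Mapping.lookup u i" by (metis not_le)
    then have "Poly_Mapping.lookup b i = Suc (Poly_Mapping.lookup u i)"
      using b(2)[of i] by (simp add: lookup_add lookup_single)
    then show ?thesis using b(1) le by blast
  qed
  then obtain h where hB: "\<And>i. h i \<in> B" and hi: "\<And>i. Poly_Mapping.lookup (h i) i = Suc (Poly_Mapping.lookup u i)"
    and hl: "\<And>i l. l \<noteq> i \<Longrightarrow> Poly_Mapping.lookup (h i) l \<le> Poly_Mapping.lookup u l"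
    by metis
  fix i
  have "mdeg (h i) = mdeg g" using B g hB unfolding exchange_family_def by blast
  have "\<exists>k. Poly_Mapping.lookup (h i) k < Poly_Mapping.lookup u k"
  proof (rule ccontr)
    assume "\<not> ?thesis"
    then have "Poly_Mapping.lookup u l \<le> Poly_Mapping.lookup (h i) l" for l by (simp add: not_less)
    then have "mdeg u < mdeg (h i)"
      unfolding mdeg_def by (intro sum_strict_mono_ex1 ballI bexI[of _ i]) (simp_all add: hi)
    then show False using deg \<open>mdeg (h i) = mdeg g\<close> by simp
  qed
  then obtain k where k: "Poly_Mapping.lookup (h i) k < Poly_Mapping.lookup u k" by blast
  then have "k \<noteq> i" using hi[of i] by auto
  have "Poly_Mapping.lookup (h i) i > Poly_Mapping.lookup (h k) i" using hi[of i] hl[of i k] \<open>k \<noteq> i\<close> by simp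
  then obtain j where j: "Poly_Mapping.lookup (h i) j < Poly_Mapping.lookup (h k) j"
    and mem: "var_expo j + (h i - var_expo i) \<in> B" (is "?b \<in> B")
    using B hB unfolding exchange_family_def by blast
  have "j \<noteq> i" using j hi[of i] hl[of i k] \<open>k \<noteq> i\<close> by auto
  \<comment> \<open>The incoming unit at \<open>j\<close> fits under \<open>u\<close>: for
    \<open>j = k\<close> by the choice of \<open>k\<close>, otherwise because \<open>h i\<close> is
    below \<open>h k\<close> at \<open>j\<close> and \<open>h k\<close> is at most \<open>u\<close>
    there.\<close>
  have "Poly_Mapping.lookup ?b l \<le> Poly_Mapping.lookup u l" for l
  proof -
    have "Poly_Mapping.lookup ?b l = (if l = j then Suc (Poly_Mapping.lookup (h i) l)
       else if l = i then Poly_Mapping.lookup (h i) l - 1 else Poly_Mapping.lookup (h i) l)"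
      using hi[of i] \<open>j \<noteq> i\<close> by (intro lookup_move) auto
    then show ?thesis
      using hi[of i] hl[of l i] hl[of j k] j k \<open>j \<noteq> i\<close> by (cases "j = k") (auto split: if_splits)
  qed
  then show False using u[OF mem] by (meson not_less)
qed

section \<open>Membership through supports, colon ideals and homogeneous components\<close>

lemma poly_mapping_sum_single:
  "f = (\<Sum>a\<in>Poly_Mapping.keys f. Poly_Mapping.single a (Poly_Mapping.lookup f a))"
  by (rule poly_mapping_eqI) (simp add: lookup_sum lookup_single when_def in_keys_iff)

lemma keys_span_xmon:
  fixes f :: "('x, 'k::comm_ring_1) mpol"
  assumes "f \<in> ideal.span (xmon ` A)" "a \<in> Poly_Mapping.keys f"
  shows "\<exists>b\<in>A. \<exists>c. a = b + c"
proof -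
  have "\<forall>a\<in>Poly_Mapping.keys f. \<exists>b\<in>A. \<exists>c. a = b + c"
    using assms(1)
  proof (induction rule: ideal.span_induct_alt)
    case (step c x y)
    show ?case
    proof
      fix a assume "a \<in> Poly_Mapping.keys (c * x + y)"
      then have "a \<in> Poly_Mapping.keys (c * x) \<or> a \<in> Poly_Mapping.keys y"
        using Poly_Mapping.keys_add[of "c * x" y] by blast
      then show "\<exists>b\<in>A. \<exists>c. a = b + c"
      proof
        assume "a \<in> Poly_Mapping.keys (c * x)"
        then obtain p q where pq: "a = p + q" "q \<in> Poly_Mapping.keys x" using keys_mult[of c x] by blast
        obtain b where "b \<in> A" "x = xmon b" using step by blast
        then have "a = b + p" using pq by (simp add: xmon_def add.commute split: if_splits)
        then show ?thesis using \<open>b \<in> A\<close> by blast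
      qed (use step in blast)
    qed
  qed simp
  then show ?thesis using assms(2) by blast
qed

lemma mem_if_keys:
  fixes f :: "('x, 'k::comm_ring_1) mpol"
  assumes J: "ideal.subspace J" and "\<And>a. a \<in> Poly_Mapping.keys f \<Longrightarrow> xmon a \<in> J"
  shows "f \<in> J"
proof -
  have "Poly_Mapping.single a (Poly_Mapping.lookup f a) = Poly_Mapping.single 0 (Poly_Mapping.lookup f a) * xmon a" for a
    by (simp add: xmon_def mult_single)
  then have "(\<Sum>a\<in>Poly_Mapping.keys f. Poly_Mapping.single a (Poly_Mapping.lookup f a)) \<in> J"
    using assms by (auto intro!: ideal.subspace_sum[OF J] ideal.subspace_scale[OF J])
  then show ?thesis using poly_mapping_sum_single[of f] by simp
qed

lemma xmon_in_monomial_ideal_iff: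
  fixes J :: "('x::finite, 'k::comm_ring_1) mpol set"
  assumes "monomial_ideal J"
  shows "xmon a \<in> J \<longleftrightarrow> (\<exists>b\<in>min_gens J. \<exists>c. a = b + c)"
  using min_gens_eq(1)[OF assms] xmon_in_span_iff[of a "min_gens J"] unfolding is_min_gens_def by metis

lemma monomial_ideal_keys:
  fixes J :: "('x::finite, 'k::comm_ring_1) mpol set"
  assumes "monomial_ideal J" "f \<in> J" "a \<in> Poly_Mapping.keys f"
  shows "xmon a \<in> J"
  using assms(1) keys_span_xmon[of f _ a] assms(2,3) xmon_in_span_iff[of a]
  unfolding monomial_ideal_def by metis

lemma ideal_colon_max_ideal_iff:
  fixes J :: "('x, 'k::comm_ring_1) mpol set"
  assumes J: "ideal.subspace J"
  shows "f \<in> ideal_colon J max_ideal \<longleftrightarrow> (\<forall>i. xvar i * f \<in> J)"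
proof
  assume "f \<in> ideal_colon J max_ideal"
  then have "f * xvar i \<in> J" for i
    unfolding ideal_colon_def max_ideal_def by (blast intro: ideal.span_base)
  then show "\<forall>i. xvar i * f \<in> J" by (simp add: mult.commute)
next
  assume f: "\<forall>i. xvar i * f \<in> J"
  have "f * g \<in> J" if "g \<in> max_ideal" for g
    using that unfolding max_ideal_def
  proof (induction rule: ideal.span_induct_alt)
    case base
    then show ?case using ideal.subspace_0[OF J] by simp
  next
    case (step c x y)
    then have "x * f \<in> J" using f by blast
    then have "c * (x * f) \<in> J" by (rule ideal.subspace_scale[OF J])
    then have "c * (x * f) + f * y \<in> J" using step by (intro ideal.subspace_add[OF J])
    moreover have "f * (c * x + y) = c * (x * f) + f * y" by (simp only: distrib_left mult_ac)
    ultimately show ?case by simp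
  qed
  then show "f \<in> ideal_colon J max_ideal" by (simp add: ideal_colon_def)
qed

lemma xvar_mult_xmon: "xvar i * xmon a = (xmon (a + var_expo i) :: ('x, 'k::comm_ring_1) mpol)"
  by (simp add: xmon_def mult_single add.commute)

lemma lookup_hom_component:
  "Poly_Mapping.lookup (hom_component d f) b = (if mdeg b = d then Poly_Mapping.lookup f b else 0)"
  unfolding hom_component_def
  by (simp add: lookup_sum lookup_single when_def in_keys_iff)

lemma homogeneous_hom_component: "homogeneous (int d) (hom_component d f)"
  by (auto simp: homogeneous_def in_keys_iff lookup_hom_component split: if_splits)

lemma sum_hom_component: "f = (\<Sum>d\<in>mdeg ` Poly_Mapping.keys f. hom_component d f)"
proof (rule poly_mapping_eqI)
  fix b
  show "Poly_Mapping.lookup f b = Poly_Mapping.lookup (\<Sum>d\<in>mdeg ` Poly_Mapping.keys f. hom_component d f) b"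
    by (cases "b \<in> Poly_Mapping.keys f") (simp_all add: lookup_sum lookup_hom_component, simp add: in_keys_iff)
qed

lemma homogeneous_neg: "homogeneous d f \<Longrightarrow> d < 0 \<Longrightarrow> f = 0"
  unfolding homogeneous_def by (metis all_not_in_conv keys_eq_empty of_nat_less_0_iff)

section \<open>From the linear resolution to the socle and the generators\<close>

theorem proposition8p2:
  fixes I :: "('x::finite, 'k::field) mpol set"
  assumes "graded_ideal I"
    and "has_linear_resolution I"
    and "polymatroidal (ideal_mult max_ideal I)"
  shows "soc (ideal_mult max_ideal I) = I \<and> polymatroidal I"
proof -
  define J where "J = ideal_mult max_ideal I"
  define B where "B = min_gens J"
  have I: "ideal.subspace I" and comp: "\<And>f d. f \<in> I \<Longrightarrow> hom_component d f \<in> I"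
    using assms(1) by (auto simp: graded_ideal_def)
  have mono_J: "monomial_ideal J" and "J \<noteq> {0}" and B: "exchange_family B"
    using assms(3) by (auto simp: polymatroidal_iff J_def B_def)
  have J: "ideal.subspace J" unfolding J_def ideal_mult_def by (rule ideal.subspace_span)
  have "J \<subseteq> I"
    unfolding J_def ideal_mult_def
    by (rule ideal.span_minimal[OF _ I]) (auto intro: ideal.subspace_scale[OF I])
  have xvar_J: "xvar i * f \<in> J" if "f \<in> I" for i f
    unfolding J_def ideal_mult_def max_ideal_def using that by (blast intro: ideal.span_base)

  obtain d where tor: "\<And>i j. j \<noteq> d \<Longrightarrow> tor_vanishes i (int i + j) I"
    using assms(2) unfolding has_linear_resolution_def by blast
  have gen: "\<exists>w. f = (\<Sum>j\<in>UNIV. xvar j * w j) \<and> (\<forall>j. w j \<in> I \<and> homogeneous (k - 1) (w j))"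
    if f: "f \<in> I" "homogeneous k f" and k: "k \<noteq> d" for f k
  proof -
    have "tor_vanishes 0 k I" using tor[OF k, of 0] by simp
    then obtain w where "f = (\<Sum>j\<in>UNIV. xvar j * w j)" "\<And>j. w j \<in> I" "\<And>j. homogeneous (k - 1) (w j)"
      using f by (rule tor_0_vanishes_imp) metis
    then show ?thesis by (intro exI[of _ w]) simp
  qed

  define D where "D = (LEAST D. \<exists>f\<in>I. f \<noteq> 0 \<and> homogeneous (int D) f)"
  have comp_ne_0: "hom_component (mdeg a) f \<noteq> 0" if "a \<in> Poly_Mapping.keys f" for a and f :: "('x, 'k) mpol"
    using that lookup_hom_component[of "mdeg a" f a] by (auto simp: in_keys_iff)
  have D_le: "D \<le> mdeg a" if "f \<in> I" "a \<in> Poly_Mapping.keys f" for f a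
    unfolding D_def
    using comp[OF that(1)] comp_ne_0[OF that(2)] homogeneous_hom_component by (intro Least_le) blast
  obtain f0 where f0: "f0 \<in> I" "f0 \<noteq> 0" "homogeneous (int D) f0"
  proof -
    obtain f where f: "f \<in> I" "f \<noteq> 0"
      using \<open>J \<noteq> {0}\<close> \<open>J \<subseteq> I\<close> ideal.subspace_0[OF J] by blast
    then obtain a where a: "a \<in> Poly_Mapping.keys f"
      by (metis all_not_in_conv keys_eq_empty)
    have "\<exists>f\<in>I. f \<noteq> 0 \<and> homogeneous (int (mdeg a)) f"
      using comp[OF f(1)] comp_ne_0[OF a] homogeneous_hom_component by blast
    then have "\<exists>f\<in>I. f \<noteq> 0 \<and> homogeneous (int D) f" unfolding D_def by (rule LeastI)
    then show thesis using that by blast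
  qed
  \<comment> \<open>The line of the resolution is the initial degree of \<open>I\<close>: otherwise
    \<open>f0\<close> would have cofactors in \<open>I\<close> of degree \<open>D - 1\<close>, which
    vanish by minimality of \<open>D\<close>.\<close>
  have d: "d = int D"
  proof (rule ccontr)
    assume "d \<noteq> int D"
    then obtain w where w: "f0 = (\<Sum>j\<in>UNIV. xvar j * w j)" "\<And>j. w j \<in> I" "\<And>j. homogeneous (int D - 1) (w j)"
      using gen[OF f0(1,3)] by metis
    have "Poly_Mapping.keys (w j) = {}" for j
      using D_le[OF w(2), of _ j] w(3)[of j] unfolding homogeneous_def by fastforce
    then have "w j = 0" for j by simp
    then show False using w(1) f0(2) by simp
  qed

  have J_deg: "D < mdeg a" if "f \<in> J" "a \<in> Poly_Mapping.keys f" for f a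
  proof -
    have "\<forall>a\<in>Poly_Mapping.keys f. D < mdeg a"
      using \<open>f \<in> J\<close> unfolding J_def ideal_mult_def
    proof (induction rule: ideal.span_induct_alt)
      case (step c x y)
      obtain g h where gh: "x = g * h" "g \<in> max_ideal" "h \<in> I" using step by blast
      have g: "0 < mdeg p" if p: "p \<in> Poly_Mapping.keys g" for p
      proof -
        have "g \<in> ideal.span (xmon ` range var_expo)"
          using gh(2) by (simp add: max_ideal_def image_image)
        then obtain i c where "p = var_expo i + c" using keys_span_xmon[OF _ p] by blast
        then show ?thesis by (simp add: mdeg_add)
      qed
      show ?case
      proof
        fix a assume "a \<in> Poly_Mapping.keys (c * x + y)"
        then have "a \<in> Poly_Mapping.keys (c * x) \<or> a \<in> Poly_Mapping.keys y"
          using Poly_Mapping.keys_add[of "c * x" y] by blast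
        then show "D < mdeg a"
        proof
          assume "a \<in> Poly_Mapping.keys (c * x)"
          then obtain r p q where "a = r + (p + q)" "p \<in> Poly_Mapping.keys g" "q \<in> Poly_Mapping.keys h"
            using keys_mult[of c x] keys_mult[of g h] gh(1) by blast
          then show ?thesis using g[of p] D_le[OF gh(3), of q] by (simp add: mdeg_add)
        qed (use step in blast)
      qed
    qed simp
    then show ?thesis using that(2) by blast
  qed
  have xmon_J: "xmon a \<in> J \<longleftrightarrow> (\<exists>b\<in>B. \<exists>c. a = b + c)" for a
    unfolding B_def by (rule xmon_in_monomial_ideal_iff[OF mono_J])
  have B_J: "xmon b \<in> J" if "b \<in> B" for b
    unfolding xmon_J using that by (metis add.right_neutral)
  have xmon_deg: "D < mdeg a" if "xmon a \<in> J" for a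
    using J_deg[OF that, of a] by (simp add: xmon_def)
  obtain a0 where a0: "a0 \<in> Poly_Mapping.keys f0" using f0(2) by (metis all_not_in_conv keys_eq_empty)
  \<comment> \<open>\<open>I\<close> is not yet known to be monomial, but \<open>J\<close> is, so
    multiplying by a variable separates the terms of \<open>f\<close>.\<close>
  have shift: "xmon (a + var_expo i) \<in> J" if "f \<in> I" "a \<in> Poly_Mapping.keys f" for f a i
  proof -
    have "Poly_Mapping.lookup (xvar i * f) (var_expo i + a) = Poly_Mapping.lookup f a"
      by (simp add: xmon_def lookup_single_mult_add)
    then have "a + var_expo i \<in> Poly_Mapping.keys (xvar i * f)"
      using that(2) by (simp add: in_keys_iff add.commute)
    then show ?thesis using monomial_ideal_keys[OF mono_J xvar_J[OF that(1)]] by blast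
  qed
  \<comment> \<open>Multiplying the term \<open>a0\<close> of degree \<open>D\<close> by a variable
    bounds the degree of one generator of \<open>J\<close>, hence of all, by \<open>D + 1\<close>;
    the lower bound is \<open>xmon_deg\<close>.\<close>
  have B_deg: "mdeg b = D + 1" if "b \<in> B" for b
  proof -
    fix i
    obtain b' c where b': "b' \<in> B" "a0 + var_expo i = b' + c"
      using shift[OF f0(1) a0, of i] unfolding xmon_J by blast
    have "mdeg a0 = D" using f0(3) a0 by (simp add: homogeneous_def)
    then have "mdeg b' \<le> D + 1" using arg_cong[OF b'(2), of mdeg] by (simp add: mdeg_add)
    moreover have "mdeg b' = mdeg b" using B b'(1) that unfolding exchange_family_def by blast
    ultimately show ?thesis using xmon_deg[OF B_J[OF that]] by simp
  qed
  obtain b0 where b0: "b0 \<in> B" using shift[OF f0(1) a0] unfolding xmon_J by blast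

  define A where "A = {a. (xmon a :: ('x, 'k) mpol) \<in> ideal_colon J max_ideal - J}"
  have A_iff: "a \<in> A \<longleftrightarrow> (\<forall>i. (xmon (a + var_expo i) :: ('x, 'k) mpol) \<in> J) \<and> (xmon a :: ('x, 'k) mpol) \<notin> J" for a
    by (simp add: A_def ideal_colon_max_ideal_iff[OF J] xvar_mult_xmon)
  have soc: "soc J = ideal.span (xmon ` A)" by (simp add: soc_def A_def)
  \<comment> \<open>The exchange property bounds the degree from above; from below, a variable times
    \<open>x^a\<close> lies in \<open>J\<close>, which starts in degree
    \<open>D + 1\<close>.\<close>
  have A_deg: "mdeg a = D" if a: "a \<in> A" for a
  proof -
    have "mdeg a < mdeg b0"
    proof (rule mdeg_socle_less[OF B b0])
      show "\<exists>l. Poly_Mapping.lookup b l > Poly_Mapping.lookup a l" if "b \<in> B" for b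
        using a that unfolding A_iff xmon_J expo_le_iff by (metis not_le)
      show "\<exists>b\<in>B. \<forall>l. Poly_Mapping.lookup b l \<le> Poly_Mapping.lookup (a + var_expo i) l" for i
        using a unfolding A_iff xmon_J expo_le_iff by blast
    qed
    moreover have "D < mdeg (a + var_expo undefined)" using a xmon_deg unfolding A_iff by blast
    ultimately show ?thesis using B_deg[OF b0] by (simp add: mdeg_add)
  qed

  obtain i where i: "card (UNIV :: 'x set) = Suc i"
    by (metis card_eq_0_iff finite UNIV_not_empty not0_implies_Suc)
  have "xmon ` A \<subseteq> I"
  proof (rule image_subsetI)
    fix a assume a: "a \<in> A"
    show "xmon a \<in> I"
    proof (rule tor_top_vanishes_imp[OF I tor i])
      \<comment> \<open>With \<open>i\<close> one less than the number of variables, a monomial of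
        degree \<open>D\<close> in the socle of \<open>S / I\<close> would contribute to
        \<open>Tor_i\<close> on the line \<open>D + 1\<close>, which is not
        \<open>d\<close>.\<close>
      show "int D + 1 \<noteq> d" using d by simp
      show "homogeneous (int D) (xmon a)" using homogeneous_xmon[of a] A_deg[OF a] by simp
      show "xvar j * xmon a \<in> I" for j using a \<open>J \<subseteq> I\<close> unfolding A_iff xvar_mult_xmon by blast
    qed
  qed
  then have "soc J \<subseteq> I" unfolding soc by (rule ideal.span_minimal[OF _ I])
  have sub_soc: "ideal.subspace (soc J)" unfolding soc by (rule ideal.subspace_span)
  \<comment> \<open>In degree \<open>D\<close> all terms of \<open>f\<close> lie in \<open>A\<close>
    by \<open>shift\<close>, the degree being too small for \<open>J\<close>. In any other degree
    \<open>gen\<close> writes \<open>f\<close> with cofactors of degree \<open>k - 1\<close>, which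
    are 0 if \<open>k = 0\<close>.\<close>
  have hom_soc: "f \<in> soc J" if "f \<in> I" "homogeneous (int k) f" for f k
    using that
  proof (induction k arbitrary: f rule: less_induct)
    case (less k)
    show ?case
    proof (cases "k = D")
      case True
      show ?thesis
      proof (rule mem_if_keys[OF sub_soc])
        fix a assume a: "a \<in> Poly_Mapping.keys f"
        then have "mdeg a = D" using less.prems(2) True by (simp add: homogeneous_def)
        then have "a \<in> A" using shift[OF less.prems(1) a] xmon_deg[of a] unfolding A_iff by auto
        then show "xmon a \<in> soc J" unfolding soc by (blast intro: ideal.span_base)
      qed
    next
      case False
      then obtain w where w: "f = (\<Sum>j\<in>UNIV. xvar j * w j)" "\<And>j. w j \<in> I" "\<And>j. homogeneous (int k - 1) (w j)"
        using gen[OF less.prems] d by auto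
      have "w j \<in> soc J" for j
      proof (cases k)
        case 0
        then have "w j = 0" using w(3)[of j] by (intro homogeneous_neg) auto
        then show ?thesis using ideal.subspace_0[OF sub_soc] by simp
      next
        case (Suc k')
        then show ?thesis using less.IH[of k' "w j"] w(2,3)[of j] by simp
      qed
      then show ?thesis
        unfolding w(1) by (intro ideal.subspace_sum[OF sub_soc], intro ideal.subspace_scale[OF sub_soc])
    qed
  qed
  have "I \<subseteq> soc J"
  proof
    fix f assume "f \<in> I"
    then have "(\<Sum>k\<in>mdeg ` Poly_Mapping.keys f. hom_component k f) \<in> soc J"
      by (intro ideal.subspace_sum[OF sub_soc] hom_soc[OF comp homogeneous_hom_component])
    then show "f \<in> soc J" using sum_hom_component[of f] by simp
  qed
  with \<open>soc J \<subseteq> I\<close> have soc_eq: "soc J = I" by (rule subset_antisym)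

  have mono_I: "monomial_ideal I" unfolding monomial_ideal_def using soc soc_eq by metis
  have A_I: "xmon a \<in> I" if "a \<in> A" for a using \<open>xmon ` A \<subseteq> I\<close> that by blast
  have I_deg: "D \<le> mdeg a" if "xmon a \<in> I" for a
    using D_le[OF that, of a] by (simp add: xmon_def)
  \<comment> \<open>\<open>A\<close> generates \<open>I\<close> and sits in the lowest degree of
    \<open>I\<close>, so no element of \<open>A\<close> has a proper divisor in
    \<open>I\<close>.\<close>
  have "min_gens I = A"
  proof (rule Set.set_eqI)
    fix u
    have "u \<in> min_gens I \<longleftrightarrow> xmon u \<in> I \<and> (\<forall>b c. xmon b \<in> I \<and> u = b + c \<longrightarrow> b = u)"
      unfolding min_gens_eq(3)[OF mono_I] by simp
    also have "\<dots> \<longleftrightarrow> u \<in> A"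
    proof
      assume u: "xmon u \<in> I \<and> (\<forall>b c. xmon b \<in> I \<and> u = b + c \<longrightarrow> b = u)"
      then obtain a c where "a \<in> A" "u = a + c"
        unfolding soc_eq[symmetric] soc xmon_in_span_iff by blast
      then show "u \<in> A" using u A_I by metis
    next
      assume u: "u \<in> A"
      have "b = u" if "xmon b \<in> I" "u = b + c" for b c
      proof -
        have "mdeg b + mdeg c = D" using that(2) A_deg[OF u] by (simp add: mdeg_add)
        then have "mdeg c = 0" using I_deg[OF that(1)] by linarith
        then show ?thesis using that(2) by simp
      qed
      then show "xmon u \<in> I \<and> (\<forall>b c. xmon b \<in> I \<and> u = b + c \<longrightarrow> b = u)" using A_I[OF u] by blast
    qed
    finally show "u \<in> min_gens I \<longleftrightarrow> u \<in> A" .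
  qed
  \<comment> \<open>By degree count, a generator of \<open>J\<close> dividing \<open>x^u\<close>
    times a variable equals this product, since both have degree \<open>D + 1\<close>. This puts
    \<open>A\<close> into the form of \<open>exchange_family_residual\<close>.\<close>
  also have "A = {u. \<forall>k. u + var_expo k \<in> B}"
  proof (intro Set.set_eqI iffI CollectI allI)
    fix u k assume u: "u \<in> A"
    then obtain b c where bc: "b \<in> B" "u + var_expo k = b + c" unfolding A_iff xmon_J by blast
    from bc(2) have "mdeg (u + var_expo k) = mdeg (b + c)" by (rule arg_cong)
    then have "mdeg c = 0"
      unfolding mdeg_add mdeg_var_expo A_deg[OF u] B_deg[OF bc(1)] by linarith
    then show "u + var_expo k \<in> B" using bc by simp
  next
    fix u assume u: "u \<in> {u. \<forall>k. u + var_expo k \<in> B}"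
    then have "mdeg (u + var_expo undefined) = D + 1" using B_deg by blast
    then have "(xmon u :: ('x, 'k) mpol) \<notin> J" using xmon_deg[of u] by (auto simp: mdeg_add)
    then show "u \<in> A" using u B_J unfolding A_iff by blast
  qed
  finally have "exchange_family (min_gens I)" using exchange_family_residual[OF B] by simp
  moreover have "I \<noteq> {0}" using f0 by blast
  ultimately show ?thesis using soc_eq mono_I unfolding polymatroidal_iff J_def by blast
qed

end
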